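(* Let $\mathcal V$ be a multivector field on $X$, assume $X$ is invariant, let $A\subset X$ be an attractor and $A^\star:=\operatorname{Inv}(X\setminus A)$ its dual repeller. Then $$p_A(t)+p_{A^\star}(t)=p_X(t)+(1+t)q(t)$$ for some polynomial $q(t)$ with non-negative coefficients. Moreover, if $q\neq0$, then $C(A^\star,A)\neq\emptyset$.
   Context: $X$ is a finite $T_0$ topological space. For $A\subset X$, $\operatorname{cl}A$ is its closure and $\operatorname{mo}A:=\operatorname{cl}A\setminus A$. $A$ is locally closed if it is the intersection of an open and a closed subset of $X$. $H$ denotes relative singular homology. A multivector is a nonempty locally closed subset of $X$; a multivector field $\mathcal V$ on $X$ is a partition of $X$ into multivectors. For $x\in X$, $[x]$ denotes the element of $\mathcal V$ containing $x$. A multivector $V$ is critical if $H(\operatorname{cl}V,\operatorname{mo}V)\neq0$, regular otherwise. $A\subset X$ is $\mathcal V$-compatible if for every $x\in X$ either $[x]\cap A=\emptyset$ or $[x]\subset A$. Put $\Pi_{\mathcal V}(x):=[x]\cup\operatorname{cl}\{x\}$ and $\Pi_{\mathcal V}(A):=\bigcup_{x\in A}\Pi_{\mathcal V}(x)$. A full solution is a map $\varphi:\mathbb Z\to X$ with $\varphi(i+1)\in\Pi_{\mathcal V}(\varphi(i))$ for all $i$; it is essential if for every $t\in\mathbb Z$ with $[\varphi(t)]$ regular, the set $\{s\in\mathbb Z:\varphi(s)\notin[\varphi(t)]\}$ is unbounded below and unbounded above. $\operatorname{Inv}A$ is the set of $x\in A$ such that there is an essential full solution $\varphi$ with image in $A$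 and $\varphi(0)=x$; $A$ is invariant if $\operatorname{Inv}A=A$. An invariant set $A$ is an attractor if $\Pi_{\mathcal V}(A)=A$. For a full solution $\varphi$: $\operatorname{uim}^-\varphi:=\bigcap_{t\le0}\varphi((-\infty,t])$, $\operatorname{uim}^+\varphi:=\bigcap_{t\ge0}\varphi([t,\infty))$; the $\mathcal V$-hull $\langle A\rangle_{\mathcal V}$ is the intersection of all $\mathcal V$-compatible locally closed sets containing $A$; $\alpha(\varphi):=\langle\operatorname{uim}^-\varphi\rangle_{\mathcal V}$, $\omega(\varphi):=\langle\operatorname{uim}^+\varphi\rangle_{\mathcal V}$. For $A,B\subset X$ the connection set $C(A,B)$ is the set of $x\in X$ for which there is an essential full solution $\varphi$ in $X$ with $\varphi(0)=x$, $\alpha(\varphi)\subset A$, $\omega(\varphi)\subset B$. For a locally closed $A\subset X$, $\beta_i(A):=\operatorname{rank}H_i(\operatorname{cl}A,\operatorname{mo}A)$ and the Poincaré polynomial is $p_A(t):=\sum_{i\ge0}\beta_i(A)t^i$ (so $p_X(t)=\sum_i\operatorname{rank}H_i(X)t^i$). *)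

theory Defs
  imports "HOL-Analysis.Analysis" "HOL-Homology.Homology" "HOL-Computational_Algebra.Polynomial_FPS"
begin

definition cl :: "'a topology \<Rightarrow> 'a set \<Rightarrow> 'a set" where
  "cl X A = X closure_of A"

definition mo :: "'a topology \<Rightarrow> 'a set \<Rightarrow> 'a set" where
  "mo X A = cl X A - A"

definition locally_closed_in :: "'a topology \<Rightarrow> 'a set \<Rightarrow> bool" where
  "locally_closed_in X A \<longleftrightarrow> (\<exists>U C. openin X U \<and> closedin X C \<and> A = U \<inter> C)"

definition ab_rank :: "('g, 'm) monoid_scheme \<Rightarrow> nat" where
  "ab_rank G = Sup {card S | S. finite S \<and> S \<subseteq> carrier G \<and>
      (\<forall>c :: 'g \<Rightarrow> int. finprod G (\<lambda>x. x [^]\<^bsub>G\<^esub> c x) S = \<one>\<^bsub>G\<^esub> \<longrightarrow> (\<forall>x\<in>S. c x = 0))}"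

definition betti :: "'a topology \<Rightarrow> 'a set \<Rightarrow> nat \<Rightarrow> nat" where
  "betti X A i = ab_rank (relative_homology_group (int i) (subtopology X (cl X A)) (mo X A))"

definition poincare :: "'a topology \<Rightarrow> 'a set \<Rightarrow> int fps" where
  "poincare X A = Abs_fps (\<lambda>i. int (betti X A i))"

definition multivector_field :: "'a topology \<Rightarrow> 'a set set \<Rightarrow> bool" where
  "multivector_field X V \<longleftrightarrow>
     \<Union>V = topspace X \<and> (\<forall>W\<in>V. W \<noteq> {} \<and> locally_closed_in X W) \<and>
     (\<forall>W1\<in>V. \<forall>W2\<in>V. W1 \<noteq> W2 \<longrightarrow> W1 \<inter> W2 = {})"

definition cell :: "'a set set \<Rightarrow> 'a \<Rightarrow> 'a set" where
  "cell V x = (THE W. W \<in> V \<and> x \<in> W)"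

definition critical :: "'a topology \<Rightarrow> 'a set \<Rightarrow> bool" where
  "critical X W \<longleftrightarrow> (\<exists>p. \<not> trivial_group (relative_homology_group p (subtopology X (cl X W)) (mo X W)))"

definition regular :: "'a topology \<Rightarrow> 'a set \<Rightarrow> bool" where
  "regular X W \<longleftrightarrow> \<not> critical X W"

definition compatible :: "'a topology \<Rightarrow> 'a set set \<Rightarrow> 'a set \<Rightarrow> bool" where
  "compatible X V A \<longleftrightarrow> (\<forall>x\<in>topspace X. cell V x \<inter> A = {} \<or> cell V x \<subseteq> A)"

definition Pi_pt :: "'a topology \<Rightarrow> 'a set set \<Rightarrow> 'a \<Rightarrow> 'a set" where
  "Pi_pt X V x = cell V x \<union> cl X {x}"

definition Pi_set :: "'a topology \<Rightarrow> 'a set set \<Rightarrow> 'a set \<Rightarrow> 'a set" where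
  "Pi_set X V A = (\<Union>x\<in>A. Pi_pt X V x)"

definition full_solution :: "'a topology \<Rightarrow> 'a set set \<Rightarrow> (int \<Rightarrow> 'a) \<Rightarrow> bool" where
  "full_solution X V \<phi> \<longleftrightarrow> range \<phi> \<subseteq> topspace X \<and> (\<forall>i. \<phi> (i + 1) \<in> Pi_pt X V (\<phi> i))"

definition essential :: "'a topology \<Rightarrow> 'a set set \<Rightarrow> (int \<Rightarrow> 'a) \<Rightarrow> bool" where
  "essential X V \<phi> \<longleftrightarrow> full_solution X V \<phi> \<and>
     (\<forall>t. regular X (cell V (\<phi> t)) \<longrightarrow>
        (\<forall>n. \<exists>s\<le>n. \<phi> s \<notin> cell V (\<phi> t)) \<and> (\<forall>n. \<exists>s\<ge>n. \<phi> s \<notin> cell V (\<phi> t)))"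

definition Inv :: "'a topology \<Rightarrow> 'a set set \<Rightarrow> 'a set \<Rightarrow> 'a set" where
  "Inv X V A = {x\<in>A. \<exists>\<phi>. essential X V \<phi> \<and> range \<phi> \<subseteq> A \<and> \<phi> 0 = x}"

definition invariant :: "'a topology \<Rightarrow> 'a set set \<Rightarrow> 'a set \<Rightarrow> bool" where
  "invariant X V A \<longleftrightarrow> Inv X V A = A"

definition attractor :: "'a topology \<Rightarrow> 'a set set \<Rightarrow> 'a set \<Rightarrow> bool" where
  "attractor X V A \<longleftrightarrow> invariant X V A \<and> Pi_set X V A = A"

definition uim_minus :: "(int \<Rightarrow> 'a) \<Rightarrow> 'a set" where
  "uim_minus \<phi> = (\<Inter>t\<in>{..0}. \<phi> ` {..t})"

definition uim_plus :: "(int \<Rightarrow> 'a) \<Rightarrow> 'a set" where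
  "uim_plus \<phi> = (\<Inter>t\<in>{0..}. \<phi> ` {t..})"

definition V_hull :: "'a topology \<Rightarrow> 'a set set \<Rightarrow> 'a set \<Rightarrow> 'a set" where
  "V_hull X V A = \<Inter>{B. B \<subseteq> topspace X \<and> compatible X V B \<and> locally_closed_in X B \<and> A \<subseteq> B}"

definition alpha_lim :: "'a topology \<Rightarrow> 'a set set \<Rightarrow> (int \<Rightarrow> 'a) \<Rightarrow> 'a set" where
  "alpha_lim X V \<phi> = V_hull X V (uim_minus \<phi>)"

definition omega_lim :: "'a topology \<Rightarrow> 'a set set \<Rightarrow> (int \<Rightarrow> 'a) \<Rightarrow> 'a set" where
  "omega_lim X V \<phi> = V_hull X V (uim_plus \<phi>)"

definition connection_set :: "'a topology \<Rightarrow> 'a set set \<Rightarrow> 'a set \<Rightarrow> 'a set \<Rightarrow> 'a set" where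
  "connection_set X V A B = {x \<in> topspace X. \<exists>\<phi>. essential X V \<phi> \<and> \<phi> 0 = x \<and>
      alpha_lim X V \<phi> \<subseteq> A \<and> omega_lim X V \<phi> \<subseteq> B}"

end

theory Submission
  imports Defs
begin

text \<open>Write \<open>A\<^sup>*\<close> for the dual repeller. It is open and compatible with the multivector field, so
  \<open>N = X - A\<^sup>*\<close> is closed, and \<open>N - A\<close> contains no essential solution. Hence \<open>N\<close> arises from \<open>A\<close> by
  attaching regular multivectors one at a time, each attachment leaving the homology unchanged, and
  \<open>H(X, A)\<close> is isomorphic to \<open>H(X, N)\<close>, that is, to \<open>H(cl A\<^sup>*, mo A\<^sup>*)\<close>. Now the equation is a count of
  ranks in the long exact sequence of the pair \<open>(X, A)\<close>, with \<open>q\<close> the ranks of the connecting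
  homomorphism. If there is no connection from \<open>A\<^sup>*\<close> to \<open>A\<close>, then \<open>X\<close> is the topological sum of the two,
  \<open>A\<close> is a retract and the connecting homomorphism vanishes.

  The topological input is excision for covers of a finite \<open>T\<^sub>0\<close> space by two \<^emph>\<open>closed\<close> sets. It is
  proved by induction on the number of points: remove a closed point \<open>m\<close>, so that the space is
  covered by the complement of \<open>m\<close> and the least open neighbourhood of \<open>m\<close>. If the latter is the
  whole space, every subset containing \<open>m\<close> is contractible.\<close>

text \<open>The obstacle is that \<open>cl\<close> and \<open>mo\<close> lead to closed covers,
  whereas ordinary excision wants interiors that cover. Subdivision need not bring a simplex into
  one member of a closed cover: a path may switch between the two sets infinitely often. Finiteness
  of the space has to do that work, and subdivision only passes between the open sets of the
  induction. Two points dictate the algebra. \<open>ab_rank\<close> is a supremum of natural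
  numbers, informative only when the cardinalities are bounded, so finite rank is established before
  ranks are compared; homology may have torsion, so bases are taken up to torsion. And
  \<open>q\<close> must be a polynomial, which requires ranks to vanish in high degrees. Invariance
  of the whole space enters through pasts and futures: every point lies on an essential solution,
  and the past of one can be joined to the future of another. This makes the dual repeller stable
  under backward steps, hence open and compatible, and it turns any single step from the dual
  repeller into \<open>A\<close> into a connection.\<close>

section \<open>Excision for closed covers of finite spaces\<close>

text \<open>Membership in the chain group \<open>S(C) + S(D)\<close>, read off from the simplices that occur. Then
  \<open>excisive X C D\<close> says that the quotient complex \<open>S(X) / (S(C) + S(D))\<close> is acyclic.\<close>

definition small_chain :: "nat \<Rightarrow> 'a topology \<Rightarrow> 'a set \<Rightarrow> 'a set \<Rightarrow> 'a chain \<Rightarrow> bool" where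
  "small_chain p X C D c \<longleftrightarrow> singular_chain p X c \<and>
     (\<forall>f\<in>Poly_Mapping.keys c. f ` standard_simplex p \<subseteq> C \<or> f ` standard_simplex p \<subseteq> D)"

definition excisive :: "'a topology \<Rightarrow> 'a set \<Rightarrow> 'a set \<Rightarrow> bool" where
  "excisive X C D \<longleftrightarrow> (\<forall>p c. singular_chain p X c \<and> small_chain (p - Suc 0) X C D (chain_boundary p c) \<longrightarrow>
     (\<exists>e. singular_chain (Suc p) X e \<and> small_chain p X C D (c - chain_boundary (Suc p) e)))"

lemma small_chain_0 [simp]: "small_chain p X C D 0"
  by (simp add: small_chain_def)

lemma small_chain_diff:
  "\<lbrakk>small_chain p X C D a; small_chain p X C D b\<rbrakk> \<Longrightarrow> small_chain p X C D (a - b)"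
  using keys_diff[of a b] singular_chain_diff[of p X a b] unfolding small_chain_def by blast

lemma small_chain_minus: "small_chain p X C D a \<Longrightarrow> small_chain p X C D (- a)"
  using small_chain_diff[OF small_chain_0] by fastforce

lemma small_chain_add:
  "\<lbrakk>small_chain p X C D a; small_chain p X C D b\<rbrakk> \<Longrightarrow> small_chain p X C D (a + b)"
  using small_chain_diff[OF _ small_chain_minus] by fastforce

lemma singular_chain_imp_small_chain:
  "singular_chain p (subtopology X C) c \<Longrightarrow> small_chain p X C D c"
  "singular_chain p (subtopology X D) c \<Longrightarrow> small_chain p X C D c"
  by (auto simp: small_chain_def singular_chain_subtopology)

lemma small_chain_split:
  assumes "small_chain p X C D c"
  obtains a b where "singular_chain p (subtopology X C) a" "singular_chain p (subtopology X D) b"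
    "c = a + b"
proof -
  have "Poly_Mapping.keys c \<subseteq> {f. singular_simplex p (subtopology X C) f} \<union> {f. singular_simplex p (subtopology X D) f}"
    using assms by (auto simp: small_chain_def singular_chain_def singular_simplex_subtopology)
  then obtain a b where "Poly_Mapping.keys a \<subseteq> {f. singular_simplex p (subtopology X C) f}"
      "Poly_Mapping.keys b \<subseteq> {f. singular_simplex p (subtopology X D) f}" "a + b = c"
    by (rule frag_split)
  then show thesis
    by (intro that[of a b]) (auto simp: singular_chain_def)
qed

lemma small_chain_boundary:
  assumes "small_chain p X C D c"
  shows "small_chain (p - Suc 0) X C D (chain_boundary p c)"
proof -
  obtain a b where "singular_chain p (subtopology X C) a" "singular_chain p (subtopology X D) b"
    "c = a + b"
    using assms by (rule small_chain_split)
  then show ?thesis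
    using singular_chain_boundary[of p _ a] singular_chain_boundary[of p _ b]
    by (simp add: chain_boundary_add singular_chain_imp_small_chain small_chain_add)
qed

lemma small_chain_subtopology:
  "small_chain p (subtopology X U) C D c \<longleftrightarrow> small_chain p X C D c \<and> singular_chain p (subtopology X U) c"
  unfolding small_chain_def singular_chain_subtopology by blast

lemma small_chain_degree_0:
  assumes "singular_chain 0 X c" "topspace X \<subseteq> C \<union> D"
  shows "small_chain 0 X C D c"
proof -
  have "f ` standard_simplex 0 \<subseteq> C \<or> f ` standard_simplex 0 \<subseteq> D" if "f \<in> Poly_Mapping.keys c" for f
  proof -
    have "singular_simplex 0 X f"
      using assms(1) that by (auto simp: singular_chain_def)
    then have "f ` standard_simplex 0 \<subseteq> topspace X"
      using continuous_map_image_subset_topspace[of _ X f]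
      by (fastforce simp: singular_simplex_def topspace_standard_simplex)
    then show ?thesis
      using assms(2) by (auto simp: standard_simplex_0)
  qed
  then show ?thesis
    using assms(1) by (simp add: small_chain_def)
qed

lemma excisiveD:
  assumes "excisive X C D" "singular_chain p X c" "small_chain (p - Suc 0) X C D (chain_boundary p c)"
  obtains e where "singular_chain (Suc p) X e" "small_chain p X C D (c - chain_boundary (Suc p) e)"
  using assms unfolding excisive_def by blast

text \<open>A Mayer--Vietoris argument on the quotient complexes: after subdivision a relative cycle is \<open>u + w\<close>
  with \<open>u\<close> in \<open>U\<close> and \<open>w\<close> in \<open>W\<close>, and up to small chains the boundary of \<open>u\<close> is a cycle of \<open>U \<inter> W\<close>,
  whose filling \<open>e\<close> turns \<open>u - e\<close> and \<open>w + e\<close> into relative cycles of \<open>U\<close> and \<open>W\<close>.\<close>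

lemma excisive_glue:
  assumes UW: "openin X U" "openin X W" "topspace X \<subseteq> U \<union> W"
    and eU: "excisive (subtopology X U) C D" and eW: "excisive (subtopology X W) C D"
    and eUW: "excisive (subtopology X (U \<inter> W)) C D" and cov: "topspace X \<subseteq> C \<union> D"
  shows "excisive X C D"
  unfolding excisive_def
proof (intro allI impI, elim conjE)
  fix p c
  assume c: "singular_chain p X c" and dc: "small_chain (p - Suc 0) X C D (chain_boundary p c)"
  obtain n where n: "\<And>m f. \<lbrakk>n \<le> m; f \<in> Poly_Mapping.keys ((singular_subdivision p ^^ m) c)\<rbrakk>
                             \<Longrightarrow> \<exists>V \<in> {U,W}. f \<in> (standard_simplex p) \<rightarrow> V"
    using sufficient_iterated_singular_subdivision_exists [of "{U,W}" X p c] UW c by auto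
  obtain h where
    h0: "\<And>p. h p 0 = (0 :: 'a chain)"
    and hdiff: "\<And>p c1 c2. h p (c1-c2) = h p c1 - h p c2"
    and hSuc: "\<And>p X c. singular_chain p X c \<Longrightarrow> singular_chain (Suc p) X (h p c)"
    and hchain: "\<And>p X c. singular_chain p X c
      \<Longrightarrow> chain_boundary (Suc p) (h p c) + h (p - Suc 0) (chain_boundary p c)
        = (singular_subdivision p ^^ n) c - c"
    using chain_homotopic_iterated_singular_subdivision by blast
  define s where "s = (singular_subdivision p ^^ n) c"
  have hadd: "\<And>p c1 c2. h p (c1 + c2) = h p c1 + h p c2"
    by (metis add_diff_cancel diff_add_cancel hdiff)
  \<comment> \<open>The homotopy \<open>h\<close> works in every space at once; used in the
    subspaces on \<open>C\<close> and \<open>D\<close>, it keeps small chains small.\<close>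
  have hsmall: "small_chain (Suc q) X C D (h q a)" if small: "small_chain q X C D a" for q a
  proof -
    obtain b c where "singular_chain q (subtopology X C) b" "singular_chain q (subtopology X D) c" "a = b + c"
      using small by (rule small_chain_split)
    then show ?thesis
      by (simp add: hadd hSuc singular_chain_imp_small_chain small_chain_add)
  qed
  have s: "singular_chain p X s"
    unfolding s_def using c by (induction n) (auto simp: singular_chain_singular_subdivision)
  show "\<exists>e. singular_chain (Suc p) X e \<and> small_chain p X C D (c - chain_boundary (Suc p) e)"
  proof (cases p)
    \<comment> \<open>Degree 0 is separated because \<open>p - Suc 0\<close> is then 0 again; its
      simplices are points, which are small by \<open>cov\<close>.\<close>
    case 0
    have "small_chain p X C D c"
      using c cov 0 small_chain_degree_0 by blast
    then show ?thesis
      by (intro exI[of _ 0]) auto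
  next
    case (Suc m)
    have hdc: "small_chain p X C D (h m (chain_boundary p c))"
      using hsmall[OF dc] Suc by simp
    have cs: "c = s - chain_boundary (Suc p) (h p c) - h m (chain_boundary p c)"
      using hchain[OF c] Suc by (simp add: s_def algebra_simps)
    have ds: "small_chain m X C D (chain_boundary p s)"
    proof -
      have "chain_boundary p c = chain_boundary p s - chain_boundary p (h m (chain_boundary p c))"
        using arg_cong[OF cs, of "chain_boundary p"] hSuc[OF c]
        by (simp add: chain_boundary_diff chain_boundary_boundary_alt)
      then have "chain_boundary p s = chain_boundary p c + chain_boundary p (h m (chain_boundary p c))"
        by (metis diff_add_cancel)
      then show ?thesis
        using small_chain_add[OF dc small_chain_boundary[OF hdc]] Suc by simp
    qed
    have "Poly_Mapping.keys s \<subseteq> {f. singular_simplex p (subtopology X U) f} \<union> {f. singular_simplex p (subtopology X W) f}"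
      using s n[OF order_refl] by (force simp: s_def singular_chain_def singular_simplex_subtopology)
    then obtain u w where u: "singular_chain p (subtopology X U) u" and w: "singular_chain p (subtopology X W) w"
      and suw: "s = u + w"
      unfolding singular_chain_def by (rule frag_split) blast
    have du: "singular_chain m (subtopology X U) (chain_boundary p u)"
      and dw: "singular_chain m (subtopology X W) (chain_boundary p w)"
      using singular_chain_boundary[OF u] singular_chain_boundary[OF w] Suc by auto
    have duw: "small_chain m X C D (chain_boundary p u + chain_boundary p w)"
      using ds suw by (simp add: chain_boundary_add)
    \<comment> \<open>A simplex of \<open>chain_boundary p u\<close> that survives in the sum is
      small; one that does not also occurs in \<open>chain_boundary p w\<close>, and so lies in
      \<open>U \<inter> W\<close>.\<close>
    have "Poly_Mapping.keys (chain_boundary p u) \<subseteq>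
      Poly_Mapping.keys (chain_boundary p u + chain_boundary p w) \<union> Poly_Mapping.keys (chain_boundary p w)"
      by (metis add_diff_cancel_right' keys_diff)
    then have "Poly_Mapping.keys (chain_boundary p u) \<subseteq>
       {f. singular_simplex m (subtopology X U) f \<and> (f ` standard_simplex m \<subseteq> C \<or> f ` standard_simplex m \<subseteq> D)}
       \<union> {f. singular_simplex m (subtopology X (U \<inter> W)) f}"
      using du dw duw 
      unfolding small_chain_def singular_chain_def singular_simplex_subtopology by blast
    then obtain q v where q: "small_chain m (subtopology X U) C D q"
      and v: "singular_chain m (subtopology X (U \<inter> W)) v" and qv: "q + v = chain_boundary p u"
      apply (rule frag_split)
      apply (simp add: small_chain_def singular_chain_def)
      by blast
    have qX: "small_chain m X C D q"
      using q small_chain_subtopology by blast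
    have "chain_boundary m v = - chain_boundary m q"
      using arg_cong[OF qv, of "chain_boundary m"] u Suc 
      by (simp add: chain_boundary_add chain_boundary_boundary_alt eq_neg_iff_add_eq_0 add.commute)
    then have "small_chain (m - Suc 0) (subtopology X (U \<inter> W)) C D (chain_boundary m v)"
      using small_chain_minus[OF small_chain_boundary[OF qX]] singular_chain_boundary[OF v]
      by (simp add: small_chain_subtopology)
    then obtain e where e: "singular_chain p (subtopology X (U \<inter> W)) e"
      and ve: "small_chain m (subtopology X (U \<inter> W)) C D (v - chain_boundary p e)"
      using excisiveD[OF eUW v] Suc by blast
    have eU': "singular_chain p (subtopology X U) e" and eW': "singular_chain p (subtopology X W) e"
      using e by (meson Int_lower1 Int_lower2 singular_chain_mono)+
    have veX: "small_chain m X C D (v - chain_boundary p e)"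
      using ve small_chain_subtopology by blast
    have "chain_boundary p (u - e) = q + (v - chain_boundary p e)"
      by (simp add: chain_boundary_diff flip: qv)
    then have "small_chain (p - Suc 0) (subtopology X U) C D (chain_boundary p (u - e))"
      using small_chain_add[OF qX veX] singular_chain_boundary[OF singular_chain_diff[OF u eU']] Suc
      by (simp add: small_chain_subtopology)
    then obtain f where f: "singular_chain (Suc p) (subtopology X U) f"
      and uf: "small_chain p (subtopology X U) C D (u - e - chain_boundary (Suc p) f)"
      using excisiveD[OF eU singular_chain_diff[OF u eU']] by blast
    have "chain_boundary p (w + e) = chain_boundary p u + chain_boundary p w - q - (v - chain_boundary p e)"
      by (simp add: chain_boundary_add flip: qv)
    then have "small_chain (p - Suc 0) (subtopology X W) C D (chain_boundary p (w + e))"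
      using small_chain_diff[OF small_chain_diff[OF duw qX] veX] singular_chain_boundary[OF singular_chain_add[OF w eW']] Suc
      by (simp add: small_chain_subtopology)
    then obtain g where g: "singular_chain (Suc p) (subtopology X W) g"
      and wg: "small_chain p (subtopology X W) C D (w + e - chain_boundary (Suc p) g)"
      using excisiveD[OF eW singular_chain_add[OF w eW']] by blast
    have fgX: "singular_chain (Suc p) X f" "singular_chain (Suc p) X g"
      using f g by (simp_all add: singular_chain_subtopology)
    \<comment> \<open>The filling \<open>e\<close> cancels between the two pieces, and
      \<open>h p c\<close> undoes the subdivision.\<close>
    have "c - chain_boundary (Suc p) (f + g - h p c)
      = (u - e - chain_boundary (Suc p) f) + (w + e - chain_boundary (Suc p) g) - h m (chain_boundary p c)"
      by (subst cs) (simp add: chain_boundary_add chain_boundary_diff suw algebra_simps)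
    moreover have "small_chain p X C D \<dots>"
      by (rule small_chain_diff[OF small_chain_add hdc]) (use uf wg small_chain_subtopology in blast)+
    ultimately show ?thesis
      using singular_chain_diff[OF singular_chain_add[OF fgX] hSuc[OF c]]
      by (intro exI[of _ "f + g - h p c"]) simp
  qed
qed

text \<open>A space whose only open neighbourhood of \<open>m\<close> is the whole space contracts to \<open>m\<close>, by jumping
  to \<open>m\<close> at a single instant.\<close>

lemma trivial_relative_homology_group_minimum:
  assumes "m \<in> topspace X" "m \<in> S" and min: "\<And>U. \<lbrakk>openin X U; m \<in> U\<rbrakk> \<Longrightarrow> U = topspace X"
  shows "trivial_group (relative_homology_group p X S)"
proof -
  have hom: "homotopic_with (\<lambda>h. True) Y Y (\<lambda>x. m) id" if mY: "m \<in> topspace Y"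
    and min: "\<And>U. \<lbrakk>openin Y U; m \<in> U\<rbrakk> \<Longrightarrow> U = topspace Y" for Y
  proof -
    let ?I = "subtopology euclideanreal {0..1}"
    \<comment> \<open>The times sent to \<open>m\<close> form a closed set, so an open set
      \<open>U\<close> without \<open>m\<close> pulls back to the open set of positive times, times
      \<open>U\<close>.\<close>
    define h where "h = (\<lambda>z::real \<times> 'a. if fst z = 0 then m else snd z)"
    have "continuous_map (prod_topology ?I Y) Y h"
      unfolding continuous_map_def
    proof (intro conjI allI impI)
      show "h \<in> topspace (prod_topology ?I Y) \<rightarrow> topspace Y"
        using mY by (auto simp: h_def)
    next
      fix U assume U: "openin Y U"
      show "openin (prod_topology ?I Y) {x \<in> topspace (prod_topology ?I Y). h x \<in> U}"
      proof (cases "m \<in> U")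
        case True
        then have "{x \<in> topspace (prod_topology ?I Y). h x \<in> U} = topspace (prod_topology ?I Y)"
          using min[OF U] mY by (auto simp: h_def)
        then show ?thesis by (metis openin_topspace)
      next
        case False
        then have "{x \<in> topspace (prod_topology ?I Y). h x \<in> U} = ({0..1} \<inter> {0<..}) \<times> U"
          using openin_subset[OF U] by (auto simp: h_def)
        moreover have "openin ?I ({0..1} \<inter> {0<..})"
          by (metis Int_commute open_greaterThan open_openin openin_subtopology_Int)
        ultimately show ?thesis
          using U by (simp add: openin_prod_Times_iff)
      qed
    qed
    then show ?thesis
      unfolding homotopic_with_def by (intro exI[of _ h]) (auto simp: h_def)
  qed
  have mS: "m \<in> topspace (subtopology X S)"
    using assms by simp
  show ?thesis
  proof (rule trivial_relative_homology_group_gen[where f = "\<lambda>x. m"])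
    show "homotopic_with (\<lambda>h. True) (subtopology X S) (subtopology X S) (\<lambda>x. m) id"
      using mS by (rule hom) (use min in \<open>force simp: openin_subtopology\<close>)
    show "homotopic_with (\<lambda>h. True) X X (\<lambda>x. m) id"
      using assms by (intro hom) auto
  qed (use mS in auto)
qed

lemma trivial_relative_homology_group_imp_relboundary:
  assumes "trivial_group (relative_homology_group (int p) X S)" "singular_relcycle p X S c"
  shows "singular_relboundary p X S c"
proof -
  have "homologous_rel_set p X S c \<in> carrier (relative_homology_group (int p) X S)"
    using assms(2) by (simp add: carrier_relative_homology_group)
  then have "homologous_rel_set p X S c = singular_relboundary_set p X S"
    using assms(1) by (simp add: trivial_group_def)
  then show ?thesis
    by (simp add: homologous_rel_set_eq_relboundary)
qed

text \<open>If \<open>m\<close> is missing from \<open>C\<close> or from \<open>D\<close>, the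
  complement of that set is a neighbourhood of \<open>m\<close>, hence everything, and all chains
  lie in the other set. Otherwise the pairs of \<open>C\<close>, of \<open>D\<close> and of
  \<open>X\<close> with \<open>C \<inter> D\<close> are all acyclic, and three fillings reduce
  \<open>c\<close> to a small chain.\<close>

lemma excisive_minimum:
  assumes m: "m \<in> topspace X" and min: "\<And>U. \<lbrakk>openin X U; m \<in> U\<rbrakk> \<Longrightarrow> U = topspace X"
    and C: "closedin X (topspace X \<inter> C)" and D: "closedin X (topspace X \<inter> D)" and cov: "topspace X \<subseteq> C \<union> D"
  shows "excisive X C D"
proof (cases "m \<in> C \<inter> D")
  case False
  then have "topspace X \<subseteq> C \<or> topspace X \<subseteq> D"
    using min[of "topspace X - topspace X \<inter> C"] min[of "topspace X - topspace X \<inter> D"] C D m cov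
    by blast
  then have small: "small_chain p X C D c" if "singular_chain p X c" for p c
    using that singular_chain_imp_small_chain(1)[of p X "topspace X \<inter> C" c D]
      singular_chain_imp_small_chain(2)[of p X "topspace X \<inter> D" c C]
    by (smt (verit) inf.absorb_iff1 subtopology_topspace singular_chain_imp_small_chain subtopology_restrict)
  show ?thesis
    unfolding excisive_def by (metis chain_boundary_0 diff_zero singular_chain_0 small)
next
  case True
  show ?thesis
    unfolding excisive_def
  proof (intro allI impI, elim conjE)
    fix p c
    assume c: "singular_chain p X c" and dc: "small_chain (p - Suc 0) X C D (chain_boundary p c)"
    let ?CD = "subtopology X (C \<inter> D)"
    obtain a b where a: "singular_chain (p - Suc 0) (subtopology X C) a"
      and b: "singular_chain (p - Suc 0) (subtopology X D) b" and ab: "chain_boundary p c = a + b"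
      using dc by (rule small_chain_split)
    show "\<exists>e. singular_chain (Suc p) X e \<and> small_chain p X C D (c - chain_boundary (Suc p) e)"
    proof (cases p)
      case 0
      have "small_chain p X C D c"
        using c cov 0 small_chain_degree_0 by blast
      then show ?thesis
        by (intro exI[of _ 0]) auto
    next
      case (Suc n)
      have fill: "\<exists>a' i. singular_chain p (subtopology X E) a' \<and> singular_chain n ?CD i \<and> chain_boundary p a' + i = a"
        if E: "C \<inter> D \<subseteq> E" and a: "singular_chain n (subtopology X E) a"
          and da: "singular_chain (n - Suc 0) ?CD (chain_boundary n a)" for E a
      proof -
        have [simp]: "E \<inter> (C \<inter> D) = C \<inter> D"
          using E by blast
        have "trivial_group (relative_homology_group (int n) (subtopology X E) (C \<inter> D))"
          by (rule trivial_relative_homology_group_minimum[of m])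
             (use True m E min in \<open>force simp: openin_subtopology\<close>)+
        moreover have "singular_relcycle n (subtopology X E) (C \<inter> D) a"
          using a da by (simp add: singular_relcycle subtopology_subtopology)
        ultimately have "singular_relboundary n (subtopology X E) (C \<inter> D) a"
          by (rule trivial_relative_homology_group_imp_relboundary)
        then show ?thesis
          by (auto simp: singular_relboundary subtopology_subtopology Suc)
      qed
      \<comment> \<open>The boundaries of \<open>a\<close> and \<open>b\<close> cancel, so each lies
        in both \<open>C\<close> and \<open>D\<close>: \<open>a\<close> and \<open>b\<close> are
        cycles relative to \<open>C \<inter> D\<close>.\<close>
      have dab: "chain_boundary n a + chain_boundary n b = 0"
        using c Suc by (metis ab chain_boundary_add chain_boundary_boundary_alt)
      then have "chain_boundary n a = - chain_boundary n b"
        by (simp add: eq_neg_iff_add_eq_0)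
      then have da: "singular_chain (n - Suc 0) ?CD (chain_boundary n a)"
        using singular_chain_boundary[OF a] singular_chain_boundary[OF b] Suc
        by (fastforce simp: singular_chain_subtopology)
      then have db: "singular_chain (n - Suc 0) ?CD (chain_boundary n b)"
        using dab by (metis add_eq_0_iff singular_chain_minus)
      obtain a' i where a': "singular_chain p (subtopology X C) a'" "singular_chain n ?CD i" "chain_boundary p a' + i = a"
        using fill[of C a] a da Suc by auto
      obtain b' j where b': "singular_chain p (subtopology X D) b'" "singular_chain n ?CD j" "chain_boundary p b' + j = b"
        using fill[of D b] b db Suc by auto
      define z where "z = c - a' - b'"
      have "chain_boundary p z = i + j"
        unfolding z_def chain_boundary_diff ab a'(3)[symmetric] b'(3)[symmetric] by simp
      moreover have zX: "singular_chain p X z"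
        using c a'(1) b'(1) unfolding z_def by (intro singular_chain_diff) (simp_all add: singular_chain_subtopology)
      ultimately have "singular_relcycle p X (C \<inter> D) z"
        using a'(2) b'(2) Suc by (simp add: singular_relcycle singular_chain_add)
      moreover have "trivial_group (relative_homology_group (int p) X (C \<inter> D))"
        by (rule trivial_relative_homology_group_minimum[of m]) (use True m min in auto)
      ultimately have "singular_relboundary p X (C \<inter> D) z"
        using trivial_relative_homology_group_imp_relboundary by blast
      then obtain e k where e: "singular_chain (Suc p) X e" and k: "singular_chain p ?CD k"
        and ek: "chain_boundary (Suc p) e + k = z"
        by (auto simp: singular_relboundary)
      have "c - chain_boundary (Suc p) e = a' + b' + k"
        using ek by (simp add: z_def algebra_simps)
      moreover have "small_chain p X C D \<dots>"
        using a' b' k by (intro small_chain_add)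
          (simp_all add: singular_chain_imp_small_chain singular_chain_subtopology small_chain_def)
      ultimately show ?thesis
        using e by metis
    qed
  qed
qed

text \<open>A minimal nonempty closed set has one point: an open set separating two of its points
  would cut out a smaller nonempty closed set.\<close>

lemma finite_t0_closed_point:
  assumes "finite (topspace X)" "t0_space X" "topspace X \<noteq> {}"
  obtains m where "m \<in> topspace X" "closedin X {m}"
proof -
  let ?F = "{C. closedin X C \<and> C \<noteq> {}}"
  have "finite ?F"
    using assms(1) by (rule_tac finite_subset[of _ "Pow (topspace X)"]) (auto dest: closedin_subset)
  moreover have "topspace X \<in> ?F"
    using assms(3) by auto
  ultimately obtain C where C: "C \<in> ?F" "\<And>B. B \<in> ?F \<Longrightarrow> B \<subseteq> C \<Longrightarrow> B = C"
    using finite_has_minimal[of ?F] by (metis (no_types, lifting) empty_iff)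
  have CX: "C \<subseteq> topspace X"
    using C(1) closedin_subset by blast
  have "x = y" if xy: "x \<in> C" "y \<in> C" for x y
  proof (rule ccontr)
    assume "x \<noteq> y"
    then obtain U where U: "openin X U" "(x \<notin> U) \<noteq> (y \<notin> U)"
      using assms(2) xy CX unfolding t0_space_def by (metis subsetD)
    then have "C - U \<in> ?F" "C - U \<noteq> C"
      using C(1) xy by (auto simp: closedin_diff)
    then show False
      using C(2) by blast
  qed
  then obtain m where "C = {m}"
    using C(1) by blast
  then show ?thesis
    using that C(1) CX by auto
qed

lemma finite_minimal_open_neighbourhood:
  assumes "finite (topspace X)" "m \<in> topspace X"
  obtains W where "openin X W" "m \<in> W" "\<And>U. \<lbrakk>openin X U; m \<in> U\<rbrakk> \<Longrightarrow> W \<subseteq> U"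
proof
  let ?F = "{U. openin X U \<and> m \<in> U}"
  have "finite ?F"
    using assms(1) by (rule_tac finite_subset[of _ "Pow (topspace X)"]) (auto dest: openin_subset)
  then show "openin X (\<Inter>?F)"
    using assms(2) by (intro openin_Inter) auto
qed auto

text \<open>\<open>C\<close> and \<open>D\<close> need not be subsets of the space, only their
  traces are closed; thus the same two sets serve for all subspaces met in the induction.\<close>

lemma excisive_finite_closed_cover:
  assumes "finite (topspace X)" "t0_space X"
    "closedin X (topspace X \<inter> C)" "closedin X (topspace X \<inter> D)" "topspace X \<subseteq> C \<union> D"
  shows "excisive X C D"
  using assms
proof (induction "card (topspace X)" arbitrary: X rule: less_induct)
  case less
  show ?case
  proof (cases "topspace X = {}")
    case True
    then show ?thesis
      by (simp add: excisive_def singular_chain_empty)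
  next
    case False
    then obtain m where m: "m \<in> topspace X" "closedin X {m}"
      using finite_t0_closed_point[OF less.prems(1,2)] by blast
    obtain W where W: "openin X W" "m \<in> W" "\<And>U. \<lbrakk>openin X U; m \<in> U\<rbrakk> \<Longrightarrow> W \<subseteq> U"
      using finite_minimal_open_neighbourhood[OF less.prems(1) m(1)] by blast
    have sub: "excisive (subtopology X Y) C D" if "topspace X \<inter> Y \<noteq> topspace X" for Y
    proof (rule less.hyps)
      show "card (topspace (subtopology X Y)) < card (topspace X)"
        using that less.prems(1) by (auto intro!: psubset_card_mono)
      show "t0_space (subtopology X Y)"
        using less.prems(2) by (rule t0_space_subtopology)
      have "closedin (subtopology X Y) (topspace (subtopology X Y) \<inter> E)" if "closedin X (topspace X \<inter> E)" for E
        using closedin_subtopology_Int_closed[OF that, of Y] by (simp add: inf_commute inf_left_commute)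
      then show "closedin (subtopology X Y) (topspace (subtopology X Y) \<inter> C)"
           "closedin (subtopology X Y) (topspace (subtopology X Y) \<inter> D)"
        using less.prems(3,4) by blast+
      show "finite (topspace (subtopology X Y))" "topspace (subtopology X Y) \<subseteq> C \<union> D"
        using less.prems(1,5) by auto
    qed
    show ?thesis
    proof (cases "W = topspace X")
      case True
      then have "\<And>U. \<lbrakk>openin X U; m \<in> U\<rbrakk> \<Longrightarrow> U = topspace X"
        using W(3) openin_subset by blast
      then show ?thesis
        using m(1) less.prems by (intro excisive_minimum) blast+
    next
      case False
      let ?U = "topspace X - {m}"
      have "W \<subset> topspace X"
        using False openin_subset[OF W(1)] by blast
      show ?thesis
      proof (rule excisive_glue[of X ?U W])
        show "openin X ?U"
          using m(2) by blast
        show "excisive (subtopology X ?U) C D" "excisive (subtopology X (?U \<inter> W)) C D"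
          using m(1) by (intro sub; blast)+
        show "excisive (subtopology X W) C D"
          using \<open>W \<subset> topspace X\<close> by (intro sub) blast
        show "openin X W" "topspace X \<subseteq> ?U \<union> W" "topspace X \<subseteq> C \<union> D"
          using W less.prems by auto
      qed
    qed
  qed
qed

text \<open>Chains of \<open>C\<close> modulo those of \<open>C \<inter> D\<close> are the same as
  \<open>S(C) + S(D)\<close> modulo \<open>S(D)\<close>. By \<open>excisive\<close>, passing from
  \<open>S(C) + S(D)\<close> to all chains of \<open>X\<close> does not change homology; the proof
  carries this out on representatives.\<close>

theorem closed_excision_finite:
  assumes fin: "finite (topspace X)" "t0_space X"
    and C: "closedin X C" and D: "closedin X D" and cov: "C \<union> D = topspace X"
  shows "hom_induced p (subtopology X C) (C \<inter> D) X D id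
    \<in> iso (relative_homology_group p (subtopology X C) (C \<inter> D)) (relative_homology_group p X D)"
proof (cases "p < 0")
  \<comment> \<open>In negative degrees both groups are, by definition, the same one-element
    group.\<close>
  case True
  then show ?thesis
    unfolding iso_def bij_betw_def relative_homology_group_def by (simp add: hom_induced_trivial)
next
  case False
  then obtain n where peq: "p = int n"
    by (metis int_nat_eq not_le)
  have ex: "excisive X C D"
    using excisive_finite_closed_cover[OF fin] C D cov by (simp add: inf_absorb2 closedin_subset)
  have [simp]: "C \<inter> (C \<inter> D) = C \<inter> D"
    by blast
  have chain_Int: "singular_chain q (subtopology X (C \<inter> D)) c \<longleftrightarrow>
      singular_chain q (subtopology X C) c \<and> singular_chain q (subtopology X D) c" for q c
    by (simp add: singular_chain_subtopology) blast
  have ind: "hom_induced n (subtopology X C) (C \<inter> D) X D id (homologous_rel_set n (subtopology X C) (C \<inter> D) c)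
      = homologous_rel_set n X D c" if "singular_relcycle n (subtopology X C) (C \<inter> D) c" for c
  proof -
    have "continuous_map (subtopology X C) X id"
      by (simp add: continuous_map_from_subtopology)
    moreover have "chain_map n id c = c"
      using that chain_map_ident by (metis singular_relcycle)
    ultimately show ?thesis
      using hom_induced_chain_map[of "subtopology X C" X id "C \<inter> D" D n c] that by auto
  qed
  show ?thesis
  proof (simp add: iso_def peq carrier_relative_homology_group bij_betw_def hom_induced_hom, intro conjI)
    show "inj_on (hom_induced n (subtopology X C) (C \<inter> D) X D id)
         (homologous_rel_set n (subtopology X C) (C \<inter> D) ` singular_relcycle_set n (subtopology X C) (C \<inter> D))"
    proof (clarsimp simp: inj_on_def homologous_rel_set_eq)
      fix c c'
      assume c: "singular_relcycle n (subtopology X C) (C \<inter> D) c" "singular_relcycle n (subtopology X C) (C \<inter> D) c'"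
        and "hom_induced n (subtopology X C) (C \<inter> D) X D id (homologous_rel_set n (subtopology X C) (C \<inter> D) c)
          = hom_induced n (subtopology X C) (C \<inter> D) X D id (homologous_rel_set n (subtopology X C) (C \<inter> D) c')"
      then have "homologous_rel_set n X D c = homologous_rel_set n X D c'"
        using ind by metis
      then have "singular_relboundary n X D (c - c')"
        unfolding homologous_rel_set_eq unfolding homologous_rel_def .
      then obtain e d where e: "singular_chain (Suc n) X e" and d: "singular_chain n (subtopology X D) d"
        and ed: "chain_boundary (Suc n) e = c - c' + d"
        unfolding singular_relboundary_alt by blast
      have cC: "singular_chain n (subtopology X C) (c - c')"
        using c by (simp add: singular_relcycle singular_chain_diff)
      then have "small_chain n X C D (chain_boundary (Suc n) e)"
        using d ed by (simp add: singular_chain_imp_small_chain small_chain_add)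
      then obtain f where f: "singular_chain (Suc (Suc n)) X f"
        and sf: "small_chain (Suc n) X C D (e - chain_boundary (Suc (Suc n)) f)"
        using excisiveD[OF ex e] by auto
      obtain a b where a: "singular_chain (Suc n) (subtopology X C) a"
        and b: "singular_chain (Suc n) (subtopology X D) b"
        and ab: "e - chain_boundary (Suc (Suc n)) f = a + b"
        using sf by (rule small_chain_split)
      have "chain_boundary (Suc n) e = chain_boundary (Suc n) a + chain_boundary (Suc n) b"
        using arg_cong[OF ab, of "chain_boundary (Suc n)"] f
        by (simp add: chain_boundary_diff chain_boundary_add chain_boundary_boundary_alt)
      \<comment> \<open>The left side is a chain of \<open>C\<close> and the right side a chain of
        \<open>D\<close>, so their common value is a chain of \<open>C \<inter> D\<close>.\<close>
      then have eq: "c - c' - chain_boundary (Suc n) a = chain_boundary (Suc n) b - d"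
        using ed by (simp add: algebra_simps)
      have "singular_chain n (subtopology X C) (c - c' - chain_boundary (Suc n) a)"
        using cC a by (simp add: singular_chain_boundary_alt singular_chain_diff)
      moreover have "singular_chain n (subtopology X D) (c - c' - chain_boundary (Suc n) a)"
        using b d unfolding eq by (simp add: singular_chain_boundary_alt singular_chain_diff)
      ultimately have "singular_chain n (subtopology X (C \<inter> D)) (c - c' - chain_boundary (Suc n) a)"
        by (simp add: chain_Int)
      then show "homologous_rel n (subtopology X C) (C \<inter> D) c c'"
        unfolding homologous_rel_def singular_relboundary
        using a by (intro exI[of _ a] exI[of _ "c - c' - chain_boundary (Suc n) a"]) (simp add: subtopology_subtopology)
    qed
    show "hom_induced n (subtopology X C) (C \<inter> D) X D id `
        homologous_rel_set n (subtopology X C) (C \<inter> D) ` singular_relcycle_set n (subtopology X C) (C \<inter> D)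
      = homologous_rel_set n X D ` singular_relcycle_set n X D" (is "?L = ?R")
    proof
      show "?L \<subseteq> ?R"
      proof clarsimp
        fix c assume c: "singular_relcycle n (subtopology X C) (C \<inter> D) c"
        then have "singular_relcycle n X D c"
          by (auto simp: singular_relcycle subtopology_subtopology chain_Int) (simp add: singular_chain_subtopology)
        then show "hom_induced n (subtopology X C) (C \<inter> D) X D id (homologous_rel_set n (subtopology X C) (C \<inter> D) c) \<in> ?R"
          using ind[OF c] by simp
      qed
      show "?R \<subseteq> ?L"
      proof clarsimp
        fix z assume z: "singular_relcycle n X D z"
        then have "singular_chain n X z" "small_chain (n - Suc 0) X C D (chain_boundary n z)"
          by (auto simp: singular_relcycle singular_chain_imp_small_chain)
        then obtain e where e: "singular_chain (Suc n) X e"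
          and se: "small_chain n X C D (z - chain_boundary (Suc n) e)"
          using excisiveD[OF ex] by blast
        obtain c d where c: "singular_chain n (subtopology X C) c" and d: "singular_chain n (subtopology X D) d"
          and cd: "z - chain_boundary (Suc n) e = c + d"
          using se by (rule small_chain_split)
        have "chain_boundary n z = chain_boundary n c + chain_boundary n d"
          using arg_cong[OF cd, of "chain_boundary n"] e
          by (simp add: chain_boundary_diff chain_boundary_add chain_boundary_boundary_alt)
        then have "chain_boundary n c = chain_boundary n z - chain_boundary n d"
          by simp
        \<comment> \<open>Modulo \<open>D\<close> the class of \<open>z\<close> is carried by
          \<open>c\<close>, whose boundary lies in \<open>C\<close> anyway and in \<open>D\<close>
          because the boundaries of \<open>z\<close> and \<open>d\<close> do.\<close>
        then have "singular_chain (n - Suc 0) (subtopology X D) (chain_boundary n c)"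
          using z singular_chain_boundary[OF d] by (simp add: singular_relcycle singular_chain_diff)
        then have rc: "singular_relcycle n (subtopology X C) (C \<inter> D) c"
          using c singular_chain_boundary[OF c] by (simp add: singular_relcycle subtopology_subtopology chain_Int)
        have "homologous_rel n X D z c"
          unfolding homologous_rel_def singular_relboundary
          using e d cd by (intro exI[of _ e] exI[of _ d]) (simp add: algebra_simps)
        then have "homologous_rel_set n X D z = homologous_rel_set n X D c"
          by (simp add: homologous_rel_set_eq)
        then show "homologous_rel_set n X D z \<in> ?L"
          using ind[OF rc] rc by (metis (no_types, lifting) imageI mem_Collect_eq)
      qed
    qed
  qed
qed

section \<open>The rank of an abelian group\<close>

definition lincomb :: "('g, 'm) monoid_scheme \<Rightarrow> ('g \<Rightarrow> int) \<Rightarrow> 'g set \<Rightarrow> 'g" where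
  "lincomb G c S = finprod G (\<lambda>x. x [^]\<^bsub>G\<^esub> c x) S"

text \<open>This is the condition inside \<open>ab_rank\<close>, which is therefore the supremum of
  \<open>card S\<close> over the independent \<open>S\<close>.\<close>

definition indep :: "('g, 'm) monoid_scheme \<Rightarrow> 'g set \<Rightarrow> bool" where
  "indep G S \<longleftrightarrow> finite S \<and> S \<subseteq> carrier G \<and> (\<forall>c. lincomb G c S = \<one>\<^bsub>G\<^esub> \<longrightarrow> (\<forall>x\<in>S. c x = 0))"

text \<open>Membership in the rational span of \<open>S\<close> after tensoring with the rationals;
  \<open>k\<close> clears denominators and kills torsion.\<close>

definition depends_on :: "('g, 'm) monoid_scheme \<Rightarrow> 'g set \<Rightarrow> 'g \<Rightarrow> bool" where
  "depends_on G S g \<longleftrightarrow> (\<exists>k c. k \<noteq> 0 \<and> g [^]\<^bsub>G\<^esub> (k::int) = lincomb G c S)"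

text \<open>A basis up to torsion. It is a relation, so that it also asserts finiteness, and
  \<open>K\<close> is a mere subset of the carrier, so that kernels and images can be inserted
  without forming subgroups.\<close>

definition rank_on :: "('g, 'm) monoid_scheme \<Rightarrow> 'g set \<Rightarrow> nat \<Rightarrow> bool" where
  "rank_on G K n \<longleftrightarrow> (\<exists>S. indep G S \<and> S \<subseteq> K \<and> card S = n \<and> (\<forall>g\<in>K. depends_on G S g))"

lemma indepD:
  assumes "indep G S" "lincomb G c S = \<one>\<^bsub>G\<^esub>" "x \<in> S"
  shows "c x = 0"
proof -
  have "\<forall>c. lincomb G c S = \<one>\<^bsub>G\<^esub> \<longrightarrow> (\<forall>x\<in>S. c x = 0)"
    using assms(1) unfolding indep_def by (elim conjE)
  then have "lincomb G c S = \<one>\<^bsub>G\<^esub> \<longrightarrow> (\<forall>x\<in>S. c x = 0)"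
    by (rule spec)
  then show ?thesis
    using assms(2,3) by simp
qed

lemma indep_imp_finite: "indep G S \<Longrightarrow> finite S"
  and indep_imp_subset: "indep G S \<Longrightarrow> S \<subseteq> carrier G"
  unfolding indep_def by (elim conjE, assumption)+

text \<open>This takes the place of the Steinitz exchange lemma in the proof that the rank is well defined.\<close>

lemma int_homogeneous_system:
  fixes a :: "'t \<Rightarrow> 's \<Rightarrow> int"
  assumes "finite S" "finite T" "card S < card T"
  shows "\<exists>d. (\<exists>t\<in>T. d t \<noteq> 0) \<and> (\<forall>s\<in>S. (\<Sum>t\<in>T. d t * a t s) = 0)"
  using assms
proof (induction S arbitrary: T a rule: finite_induct)
  case empty
  then have "T \<noteq> {}" by auto
  then show ?case by (intro exI[of _ "\<lambda>_. 1"]) auto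
next
  case (insert s S)
  show ?case
  proof (cases "\<forall>t\<in>T. a t s = 0")
    case True
    obtain d where "(\<exists>t\<in>T. d t \<noteq> 0) \<and> (\<forall>s\<in>S. (\<Sum>t\<in>T. d t * a t s) = 0)"
      using insert.IH[of T a] insert.prems insert.hyps by auto
    then show ?thesis
      using True by (intro exI[of _ d]) auto
  next
    case False
    then obtain t0 where t0: "t0 \<in> T" "a t0 s \<noteq> 0" by blast
    let ?T = "T - {t0}"
    have "card S < card ?T"
      using insert.prems insert.hyps t0 by simp
    then obtain d where d: "\<exists>t\<in>?T. d t \<noteq> 0"
      "\<And>s'. s' \<in> S \<Longrightarrow> (\<Sum>t\<in>?T. d t * (a t0 s * a t s' - a t s * a t0 s')) = 0"
      using insert.IH[of ?T "\<lambda>t s'. a t0 s * a t s' - a t s * a t0 s'"] insert.prems by auto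
    \<comment> \<open>Elimination with pivot \<open>a t0 s\<close>. Cross-multiplying instead of
      dividing keeps the solution integral, hence the factor \<open>a t0 s\<close> on the remaining
      unknowns.\<close>
    define d' where "d' t = (if t = t0 then - (\<Sum>t\<in>?T. d t * a t s) else d t * a t0 s)" for t
    have sum_d': "(\<Sum>t\<in>T. d' t * a t s') = (\<Sum>t\<in>?T. d t * a t0 s * a t s') - (\<Sum>t\<in>?T. d t * a t s) * a t0 s'" for s'
    proof -
      have "(\<Sum>t\<in>T. d' t * a t s') = d' t0 * a t0 s' + (\<Sum>t\<in>?T. d' t * a t s')"
        using t0(1) insert.prems(1) by (simp add: sum.remove)
      also have "(\<Sum>t\<in>?T. d' t * a t s') = (\<Sum>t\<in>?T. d t * a t0 s * a t s')"
        by (rule sum.cong) (auto simp: d'_def)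
      finally show ?thesis by (simp add: d'_def)
    qed
    have "(\<Sum>t\<in>T. d' t * a t s') = 0" if "s' \<in> insert s S" for s'
    proof (cases "s' = s")
      case True
      then show ?thesis by (simp add: sum_d' sum_distrib_right sum_distrib_left mult_ac)
    next
      case False
      then have "(\<Sum>t\<in>?T. d t * (a t0 s * a t s' - a t s * a t0 s')) = 0"
        using that d(2) by auto
      then show ?thesis
        by (simp add: sum_d' sum_distrib_right right_diff_distrib sum_subtractf mult.assoc)
    qed
    moreover have "\<exists>t\<in>T. d' t \<noteq> 0"
      using d(1) t0 by (auto simp: d'_def)
    ultimately show ?thesis
      by (intro exI[of _ d'] conjI ballI)
  qed
qed

context comm_group
begin

lemma lincomb_closed [simp]: "S \<subseteq> carrier G \<Longrightarrow> lincomb G c S \<in> carrier G"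
  unfolding lincomb_def by (rule finprod_closed) auto

lemma lincomb_add:
  assumes "S \<subseteq> carrier G"
  shows "lincomb G (\<lambda>x. c x + d x) S = lincomb G c S \<otimes> lincomb G d S"
proof -
  have "lincomb G (\<lambda>x. c x + d x) S = finprod G (\<lambda>x. x [^] c x \<otimes> x [^] d x) S"
    unfolding lincomb_def using assms by (intro finprod_cong) (auto simp: int_pow_mult simp_implies_def)
  then show ?thesis
    unfolding lincomb_def using assms by (simp add: finprod_multf Pi_iff subset_iff)
qed

lemma lincomb_0 [simp]: "lincomb G (\<lambda>x. 0) S = \<one>"
  unfolding lincomb_def by (rule finprod_one_eqI) simp

lemma lincomb_minus:
  assumes "S \<subseteq> carrier G"
  shows "lincomb G (\<lambda>x. - c x) S = inv (lincomb G c S)"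
proof -
  have "lincomb G (\<lambda>x. - c x) S \<otimes> lincomb G c S = \<one>"
    using lincomb_add[OF assms, of "\<lambda>x. - c x" c] by simp
  then show ?thesis
    using assms inv_equality by simp
qed

lemma lincomb_pow_nat:
  assumes "S \<subseteq> carrier G"
  shows "lincomb G (\<lambda>x. int n * c x) S = lincomb G c S [^] n"
proof (induction n)
  case (Suc n)
  have "lincomb G (\<lambda>x. int (Suc n) * c x) S = lincomb G (\<lambda>x. int n * c x + c x) S"
    by (simp add: algebra_simps)
  then show ?case
    using assms Suc by (simp add: lincomb_add)
qed (use assms in simp)

lemma lincomb_pow:
  assumes "S \<subseteq> carrier G"
  shows "lincomb G (\<lambda>x. k * c x) S = lincomb G c S [^] (k::int)"
proof (cases k)
  case (nonneg n)
  then show ?thesis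
    using assms lincomb_pow_nat by (simp add: int_pow_int)
next
  case (neg n)
  have "lincomb G (\<lambda>x. k * c x) S = lincomb G (\<lambda>x. - (int (Suc n) * c x)) S"
    unfolding neg(1) mult_minus_left ..
  then show ?thesis
    using assms neg lincomb_pow_nat[OF assms, of "Suc n"]
    by (simp add: lincomb_minus int_pow_neg int_pow_int del: of_nat_Suc)
qed

lemma lincomb_cong: "(\<And>x. x \<in> S \<Longrightarrow> c x = d x) \<Longrightarrow> S \<subseteq> carrier G \<Longrightarrow> lincomb G c S = lincomb G d S"
  unfolding lincomb_def by (rule finprod_cong') auto

lemma lincomb_insert:
  "\<lbrakk>finite S; x \<notin> S; insert x S \<subseteq> carrier G\<rbrakk> \<Longrightarrow> lincomb G c (insert x S) = x [^] c x \<otimes> lincomb G c S"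
  unfolding lincomb_def by (rule finprod_insert) auto

lemma lincomb_Un:
  "\<lbrakk>finite S; finite T; S \<inter> T = {}; S \<subseteq> carrier G; T \<subseteq> carrier G\<rbrakk>
    \<Longrightarrow> lincomb G c (S \<union> T) = lincomb G c S \<otimes> lincomb G c T"
  unfolding lincomb_def by (rule finprod_Un_disjoint) auto

lemma lincomb_single:
  assumes "finite S" "x \<in> S" "S \<subseteq> carrier G"
  shows "lincomb G (\<lambda>y. if y = x then k else 0) S = x [^] k"
proof -
  have "lincomb G (\<lambda>y. if y = x then k else 0) (S - {x}) = lincomb G (\<lambda>x. 0) (S - {x})"
    using assms by (intro lincomb_cong) auto
  moreover have "insert x (S - {x}) = S" using assms by blast
  ultimately show ?thesis
    using lincomb_insert[of "S - {x}" x "\<lambda>y. if y = x then k else 0"] assms by auto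
qed

lemma lincomb_lincomb:
  assumes "finite T" "S \<subseteq> carrier G"
  shows "finprod G (\<lambda>t. lincomb G (a t) S [^] (d t::int)) T = lincomb G (\<lambda>s. \<Sum>t\<in>T. d t * a t s) S"
  using assms(1)
proof induction
  case (insert t T)
  then show ?case
    using assms(2) by (subst finprod_insert) (auto simp: lincomb_add lincomb_pow)
qed simp

text \<open>Expressing the powers \<open>t [^] k t\<close> through \<open>S\<close>, a larger
  \<open>T\<close> would leave more unknowns than equations. A solution \<open>d\<close> gives the
  relation with exponents \<open>k t * d t\<close>, nontrivial because no \<open>k t\<close>
  vanishes.\<close>

lemma indep_card_le:
  assumes S: "finite S" "S \<subseteq> carrier G" and T: "indep G T"
    and dep: "\<And>t. t \<in> T \<Longrightarrow> depends_on G S t"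
  shows "card T \<le> card S"
proof (rule ccontr)
  assume "\<not> card T \<le> card S"
  obtain k c where kc: "\<And>t. t \<in> T \<Longrightarrow> k t \<noteq> 0 \<and> t [^] (k t::int) = lincomb G (c t) S"
    using dep unfolding depends_on_def by metis
  have T': "finite T" "T \<subseteq> carrier G"
    using T by (rule indep_imp_finite, rule indep_imp_subset)
  then obtain d where d: "\<exists>t\<in>T. d t \<noteq> 0" "\<And>s. s \<in> S \<Longrightarrow> (\<Sum>t\<in>T. d t * c t s) = 0"
    using int_homogeneous_system[OF S(1), of T c] \<open>\<not> card T \<le> card S\<close> by auto
  have "lincomb G (\<lambda>t. k t * d t) T = finprod G (\<lambda>t. lincomb G (c t) S [^] d t) T"
    unfolding lincomb_def[of G _ T] using T' S(2) kc
    by (intro finprod_cong') (auto simp: int_pow_pow[symmetric])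
  also have "\<dots> = lincomb G (\<lambda>s. 0) S"
    unfolding lincomb_lincomb[OF T'(1) S(2)] using d(2) S(2) by (intro lincomb_cong) auto
  finally have "lincomb G (\<lambda>t. k t * d t) T = \<one>"
    by simp
  note zero = indepD[OF T this]
  obtain t where "t \<in> T" "d t \<noteq> 0"
    using d(1) by blast
  then show False
    using zero[of t] kc[of t] by simp
qed

lemma rank_on_card_le:
  assumes "rank_on G K n" "indep G T" "T \<subseteq> K"
  shows "card T \<le> n"
proof -
  obtain S where S: "indep G S" "S \<subseteq> K" "card S = n"
      "\<forall>g\<in>K. depends_on G S g"
    using assms(1) unfolding rank_on_def by blast
  show ?thesis
    using indep_card_le[of S T] S assms(2,3) indep_imp_finite[of G S] indep_imp_subset[of G S] by blast
qed

lemma rank_on_unique: "\<lbrakk>rank_on G K n; rank_on G K m\<rbrakk> \<Longrightarrow> n = m"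
  by (metis le_antisym rank_on_def rank_on_card_le)

lemma ab_rank_eqI:
  assumes "rank_on G (carrier G) n"
  shows "ab_rank G = n"
proof -
  have "ab_rank G = Sup {card S | S. indep G S}"
    unfolding ab_rank_def indep_def lincomb_def by (rule arg_cong[where f = Sup]) auto
  also have "\<dots> = n"
  proof (rule cSup_eq_maximum)
    show "n \<in> {card S | S. indep G S}"
      using assms unfolding rank_on_def by blast
    show "x \<le> n" if "x \<in> {card S | S. indep G S}" for x
      using that rank_on_card_le[OF assms] indep_imp_subset[of G] by blast
  qed
  finally show ?thesis .
qed

text \<open>An independent set of greatest cardinality works: adding \<open>g\<close> creates a
  relation, and independence of the old set forces the coefficient of \<open>g\<close> in it to be
  nonzero.\<close>

lemma bounded_imp_rank_on:
  assumes K: "K \<subseteq> carrier G" and bound: "\<And>S. \<lbrakk>indep G S; S \<subseteq> K\<rbrakk> \<Longrightarrow> card S \<le> N"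
  obtains n where "rank_on G K n"
proof -
  have "indep G {}"
    by (simp add: indep_def)
  then obtain S where S: "indep G S" "S \<subseteq> K" and max: "\<And>T. \<lbrakk>indep G T; T \<subseteq> K\<rbrakk> \<Longrightarrow> card T \<le> card S"
    using ex_has_greatest_nat[of "\<lambda>S. indep G S \<and> S \<subseteq> K" "{}" card "Suc N"] bound
    by (metis empty_subsetI le_imp_less_Suc)
  have S': "finite S" "S \<subseteq> carrier G"
    using S(1) by (rule indep_imp_finite, rule indep_imp_subset)
  have "depends_on G S g" if g: "g \<in> K" for g
  proof (cases "g \<in> S")
    case True
    then show ?thesis
      using lincomb_single[OF S'(1) True S'(2), of 1] unfolding depends_on_def by (metis zero_neq_one)
  next
    case False
    have gS: "insert g S \<subseteq> carrier G"
      using g K S' by auto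
    have "\<not> indep G (insert g S)"
      using max[of "insert g S"] False S' S(2) g by auto
    then obtain c where c: "lincomb G c (insert g S) = \<one>" "\<exists>x\<in>insert g S. c x \<noteq> 0"
      unfolding indep_def using gS S' by (metis finite_insert)
    have prod: "g [^] c g \<otimes> lincomb G c S = \<one>"
      using c(1) False gS S' by (simp add: lincomb_insert)
    have "c g \<noteq> 0"
    proof
      assume "c g = 0"
      then have "lincomb G c S = \<one>"
        using prod S' by simp
      note zero = indepD[OF S(1) this]
      show False
        using c(2) \<open>c g = 0\<close> by (auto intro: zero)
    qed
    moreover have "g [^] c g = lincomb G (\<lambda>x. - c x) S"
      using prod gS S' by (simp add: lincomb_minus inv_equality[symmetric])
    ultimately show ?thesis
      unfolding depends_on_def by (intro exI conjI)
  qed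
  then have "rank_on G K (card S)"
    unfolding rank_on_def using S by blast
  then show ?thesis
    by (rule that)
qed

lemma rank_on_subset:
  assumes "rank_on G K n" "L \<subseteq> K" "K \<subseteq> carrier G"
  obtains m where "rank_on G L m" "m \<le> n"
proof -
  obtain m where m: "rank_on G L m"
    using bounded_imp_rank_on[of L n] rank_on_card_le[OF assms(1)] assms by blast
  then have "m \<le> n"
    using rank_on_card_le[OF assms(1)] assms(2) unfolding rank_on_def by blast
  with m show ?thesis using that by blast
qed

lemma rank_on_one: "rank_on G {\<one>} 0"
proof -
  have "depends_on G {} \<one>"
    unfolding depends_on_def by (intro exI[of _ 1] exI[of _ "\<lambda>_. 0"]) simp
  then show ?thesis
    unfolding rank_on_def by (intro exI[of _ "{}"]) (simp add: indep_def)
qed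

lemma rank_on_trivial_group: "trivial_group G \<Longrightarrow> rank_on G (carrier G) 0"
  using rank_on_one by (simp add: trivial_group_def)

end

section \<open>Behaviour of the rank under homomorphisms\<close>

context
  fixes G :: "('a, 'm) monoid_scheme" and H :: "('b, 'n) monoid_scheme" and f
  assumes G: "comm_group G" and H: "comm_group H" and f: "f \<in> hom G H"
begin

interpretation G: comm_group G by (fact G)
interpretation H: comm_group H by (fact H)
interpretation group_hom G H f
  using f by unfold_locales

lemma hom_lincomb_lift:
  assumes T: "finite T" "g ` T \<subseteq> carrier G" and fg: "\<And>t. t \<in> T \<Longrightarrow> f (g t) = t"
  shows "f (lincomb G c (g ` T)) = lincomb H (\<lambda>t. c (g t)) T"
proof -
  have inj: "inj_on g T"
    using fg by (metis inj_on_inverseI)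
  have TH: "T \<subseteq> carrier H"
    using fg T(2) by (metis hom_closed image_subset_iff subsetI)
  have "lincomb G c (g ` T) = finprod G (\<lambda>t. g t [^]\<^bsub>G\<^esub> c (g t)) T"
    unfolding lincomb_def using inj T by (subst G.finprod_reindex) (auto simp: image_subset_iff)
  also have "f \<dots> = finprod H (\<lambda>t. f (g t [^]\<^bsub>G\<^esub> c (g t))) T"
  proof -
    have "f (finprod G h T) = finprod H (\<lambda>t. f (h t)) T" if "h \<in> T \<rightarrow> carrier G" for h
      using T(1) that
    proof induction
      case (insert x F)
      then show ?case
        by (simp add: Pi_iff)
    qed simp
    then show ?thesis
      using T by (simp add: Pi_iff image_subset_iff)
  qed
  also have "\<dots> = lincomb H (\<lambda>t. c (g t)) T"
    unfolding lincomb_def using T fg TH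
    by (intro H.finprod_cong') (auto simp: image_subset_iff hom_int_pow)
  finally show ?thesis .
qed

text \<open>Applying \<open>f\<close> to a relation erases \<open>S\<close> and leaves a relation on
  \<open>T\<close>; once its coefficients vanish, only a relation on \<open>S\<close>
  remains.\<close>

lemma indep_Un_lift:
  assumes S: "indep G S" "S \<subseteq> kernel G H f" and T: "indep H T"
    and g: "g ` T \<subseteq> carrier G" "\<And>t. t \<in> T \<Longrightarrow> f (g t) = t"
  shows "indep G (S \<union> g ` T)" "card (S \<union> g ` T) = card S + card T"
proof -
  have fin: "finite S" "finite T" "S \<subseteq> carrier G" "T \<subseteq> carrier H"
    using S(1) T indep_imp_finite indep_imp_subset by blast+
  have inj: "inj_on g T"
    using g(2) by (metis inj_on_inverseI)
  \<comment> \<open>An independent set does not contain the unit, so no lift lies in the kernel and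
    the union below is disjoint.\<close>
  have one: "\<one>\<^bsub>H\<^esub> \<notin> T"
  proof
    assume "\<one>\<^bsub>H\<^esub> \<in> T"
    then have "lincomb H (\<lambda>y. if y = \<one>\<^bsub>H\<^esub> then 1 else 0) T = \<one>\<^bsub>H\<^esub>"
      using H.lincomb_single[OF fin(2) _ fin(4), of "\<one>\<^bsub>H\<^esub>" 1] by simp
    from indepD[OF T this \<open>\<one>\<^bsub>H\<^esub> \<in> T\<close>] show False
      by simp
  qed
  then have disj: "S \<inter> g ` T = {}"
    using S(2) g(2) by (auto simp: kernel_def)
  show "card (S \<union> g ` T) = card S + card T"
    using disj fin inj by (simp add: card_Un_disjoint card_image)
  have fS: "f (lincomb G c S) = \<one>\<^bsub>H\<^esub>" for c
  proof -
    have "lincomb G c S \<in> kernel G H f"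
      unfolding lincomb_def using fin(1) S(2)
    proof induction
      case (insert x F)
      have "finprod G (\<lambda>x. x [^]\<^bsub>G\<^esub> c x) (insert x F) = x [^]\<^bsub>G\<^esub> c x \<otimes>\<^bsub>G\<^esub> finprod G (\<lambda>x. x [^]\<^bsub>G\<^esub> c x) F"
        using insert by (intro G.finprod_insert) (auto simp: kernel_def)
      then show ?case
        using insert by (auto simp: kernel_def hom_int_pow)
    qed (simp add: kernel_def)
    then show ?thesis by (simp add: kernel_def)
  qed
  have "\<forall>x\<in>S \<union> g ` T. c x = 0" if c: "lincomb G c (S \<union> g ` T) = \<one>\<^bsub>G\<^esub>" for c
  proof -
    have prod: "lincomb G c S \<otimes>\<^bsub>G\<^esub> lincomb G c (g ` T) = \<one>\<^bsub>G\<^esub>"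
      using c G.lincomb_Un[of S "g ` T"] fin disj g(1) by simp
    then have "f (lincomb G c S) \<otimes>\<^bsub>H\<^esub> f (lincomb G c (g ` T)) = \<one>\<^bsub>H\<^esub>"
      using fin(3) g(1) by (metis G.lincomb_closed hom_mult hom_one)
    then have "lincomb H (\<lambda>t. c (g t)) T = \<one>\<^bsub>H\<^esub>"
      using fS hom_lincomb_lift[OF fin(2) g] fin(4) by simp
    note zero = indepD[OF T this]
    have cT: "\<forall>t\<in>T. c (g t) = 0"
      by (intro ballI zero)
    then have "lincomb G c (g ` T) = lincomb G (\<lambda>_. 0) (g ` T)"
      using g(1) by (intro G.lincomb_cong) auto
    then have "lincomb G c S = \<one>\<^bsub>G\<^esub>"
      using prod fin by simp
    note zero = indepD[OF S(1) this]
    show ?thesis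
      using cT by (auto intro: zero)
  qed
  then have "\<forall>c. lincomb G c (S \<union> g ` T) = \<one>\<^bsub>G\<^esub> \<longrightarrow> (\<forall>x\<in>S \<union> g ` T. c x = 0)"
    by (intro allI impI)
  moreover have "finite (S \<union> g ` T)" "S \<union> g ` T \<subseteq> carrier G"
    using fin g(1) by auto
  ultimately show "indep G (S \<union> g ` T)"
    unfolding indep_def by (intro conjI)
qed

text \<open>A kernel basis together with lifts of an image basis. Two denominators occur:
  \<open>k\<close> to express \<open>f x\<close> through \<open>T\<close>, and \<open>l\<close> to
  express the resulting kernel element through \<open>S\<close>; so \<open>x\<close> is controlled
  only after raising it to \<open>k * l\<close>.\<close>

lemma rank_nullity:
  assumes "rank_on G (kernel G H f) n" "rank_on H (f ` carrier G) m"
  shows "rank_on G (carrier G) (n + m)"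
proof -
  obtain S where S: "indep G S" "S \<subseteq> kernel G H f" "card S = n"
      "\<forall>g\<in>kernel G H f. depends_on G S g"
    using assms(1) unfolding rank_on_def by blast
  obtain T where T: "indep H T" "T \<subseteq> f ` carrier G" "card T = m"
      "\<forall>h\<in>f ` carrier G. depends_on H T h"
    using assms(2) unfolding rank_on_def by blast
  define g where "g = inv_into (carrier G) f"
  have g: "g ` T \<subseteq> carrier G" "\<And>t. t \<in> T \<Longrightarrow> f (g t) = t"
    unfolding g_def using T(2) by (auto intro: inv_into_into f_inv_into_f)
  have fin: "finite S" "finite T" "S \<subseteq> carrier G" "T \<subseteq> carrier H"
    using S(1) T(1) indep_imp_finite indep_imp_subset by blast+
  note Un = indep_Un_lift[OF S(1,2) T(1) g]
  have "depends_on G (S \<union> g ` T) x" if x: "x \<in> carrier G" for x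
  proof -
    obtain k c where k: "k \<noteq> 0" "f x [^]\<^bsub>H\<^esub> (k::int) = lincomb H c T"
      using bspec[OF T(4) imageI[OF x]] unfolding depends_on_def by (elim exE conjE)
    let ?y = "lincomb G (c \<circ> f) (g ` T)"
    have y: "?y \<in> carrier G"
      using g(1) by simp
    have "f ?y = lincomb H (\<lambda>t. (c \<circ> f) (g t)) T"
      using fin(2) g by (rule hom_lincomb_lift)
    also have "\<dots> = lincomb H c T"
      using g(2) fin(4) by (intro H.lincomb_cong) auto
    finally have fy: "f ?y = lincomb H c T" .
    have "x [^]\<^bsub>G\<^esub> k \<otimes>\<^bsub>G\<^esub> inv\<^bsub>G\<^esub> ?y \<in> kernel G H f"
      using x y k(2) fin(4) fy by (simp add: kernel_def hom_int_pow)
    from bspec[OF S(4) this] obtain l b where l: "l \<noteq> 0" "(x [^]\<^bsub>G\<^esub> k \<otimes>\<^bsub>G\<^esub> inv\<^bsub>G\<^esub> ?y) [^]\<^bsub>G\<^esub> (l::int) = lincomb G b S"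
      unfolding depends_on_def by (elim exE conjE)
    have "(x [^]\<^bsub>G\<^esub> k) [^]\<^bsub>G\<^esub> l \<otimes>\<^bsub>G\<^esub> inv\<^bsub>G\<^esub> (?y [^]\<^bsub>G\<^esub> l) = lincomb G b S"
      using l(2) x y by (simp add: G.int_pow_distrib G.int_pow_inv)
    then have "x [^]\<^bsub>G\<^esub> (k * l) = lincomb G b S \<otimes>\<^bsub>G\<^esub> ?y [^]\<^bsub>G\<^esub> l"
      using x y fin(3) by (metis G.int_pow_closed G.int_pow_pow G.inv_solve_right' G.lincomb_closed)
    also have "?y [^]\<^bsub>G\<^esub> l = lincomb G (\<lambda>z. l * (c \<circ> f) z) (g ` T)"
      by (rule G.lincomb_pow[OF g(1), symmetric])
    also have "lincomb G b S \<otimes>\<^bsub>G\<^esub> \<dots> = lincomb G (\<lambda>z. if z \<in> S then b z else l * (c \<circ> f) z) (S \<union> g ` T)"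
    proof -
      have disj: "S \<inter> g ` T = {}"
      proof -
        have "card (S \<union> g ` T) = card S + card (g ` T)"
          using Un(2) card_image[of g T] g(2) by (metis inj_on_inverseI)
        then show ?thesis
          using card_Un_Int[of S "g ` T"] fin by simp
      qed
      have "lincomb G b S = lincomb G (\<lambda>z. if z \<in> S then b z else l * (c \<circ> f) z) S"
        "lincomb G (\<lambda>z. l * (c \<circ> f) z) (g ` T) = lincomb G (\<lambda>z. if z \<in> S then b z else l * (c \<circ> f) z) (g ` T)"
        using disj fin g(1) by (intro G.lincomb_cong; auto)+
      then show ?thesis
        using G.lincomb_Un[OF fin(1) _ disj fin(3) g(1)] fin(2) by simp
    qed
    finally show ?thesis
      unfolding depends_on_def using k(1) l(1) by (intro exI conjI) auto
  qed
  then show ?thesis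
    unfolding rank_on_def using Un S(3) T(3) fin(3) g(1) by (intro exI[of _ "S \<union> g ` T"]) simp
qed

lemma rank_on_image:
  assumes "rank_on G (carrier G) n"
  obtains m where "rank_on H (f ` carrier G) m"
proof -
  have "card T \<le> n" if T: "indep H T" "T \<subseteq> f ` carrier G" for T
  proof -
    define g where "g = inv_into (carrier G) f"
    have g: "g ` T \<subseteq> carrier G" "\<And>t. t \<in> T \<Longrightarrow> f (g t) = t"
      unfolding g_def using T(2) by (auto intro: inv_into_into f_inv_into_f)
    have "indep G {}"
      by (simp add: indep_def)
    then have "indep G ({} \<union> g ` T)" "card ({} \<union> g ` T) = card {} + card T"
      using indep_Un_lift[of "{}" T g] T g by auto
    then show ?thesis
      using G.rank_on_card_le[OF assms, of "g ` T"] g(1) by simp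
  qed
  then show thesis
    using H.bounded_imp_rank_on[of "f ` carrier G" n] that by (metis hom_closed image_subsetI)
qed

lemma rank_on_iso:
  assumes "f \<in> iso G H" "rank_on G (carrier G) n"
  shows "rank_on H (carrier H) n"
proof -
  have im: "f ` carrier G = carrier H" and "inj_on f (carrier G)"
    using assms(1) by (auto simp: iso_def bij_betw_def)
  then have ker: "kernel G H f = {\<one>\<^bsub>G\<^esub>}"
    using inj_iff_trivial_ker by blast
  obtain m where m: "rank_on H (f ` carrier G) m"
    using rank_on_image assms(2) by blast
  then have "rank_on G (carrier G) (0 + m)"
    using rank_nullity[of 0 m] G.rank_on_one unfolding ker by blast
  then have "n = 0 + m"
    by (rule G.rank_on_unique[OF assms(2)])
  with m im show ?thesis
    by (simp only: add_0)
qed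

end

section \<open>Finiteness of homology and the long exact sequence\<close>

abbreviation homology_rank :: "int \<Rightarrow> 'a topology \<Rightarrow> 'a set \<Rightarrow> nat \<Rightarrow> bool" where
  "homology_rank p X S n \<equiv>
     rank_on (relative_homology_group p X S) (carrier (relative_homology_group p X S)) n"

text \<open>The first clause makes rank counts legitimate in every degree; the second is the source
  of the finite degree of \<open>q\<close>.\<close>

definition finite_type_homology :: "'a topology \<Rightarrow> 'a set \<Rightarrow> bool" where
  "finite_type_homology X S \<longleftrightarrow> (\<forall>p. \<exists>n. homology_rank p X S n) \<and> (\<exists>N. \<forall>p\<ge>N. homology_rank p X S 0)"

lemma rank_on_kernel_image:
  assumes G: "comm_group G" and H: "comm_group H" and f: "f \<in> hom G H" and r: "rank_on G (carrier G) n"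
  obtains k m where "rank_on G (kernel G H f) k" "rank_on H (f ` carrier G) m" "n = k + m"
proof -
  have "kernel G H f \<subseteq> carrier G"
    by (auto simp: kernel_def)
  then obtain k where k: "rank_on G (kernel G H f) k"
    using comm_group.rank_on_subset[OF G r] by blast
  obtain m where m: "rank_on H (f ` carrier G) m"
    using rank_on_image[OF G H f r] by blast
  have "n = k + m"
    using comm_group.rank_on_unique[OF G r rank_nullity[OF G H f k m]] .
  with k m show thesis
    by (rule that)
qed

text \<open>The bound on \<open>b\<close> is what passes rank 0, and with it vanishing in high
  degrees, from the outer terms to the middle one.\<close>

lemma rank_on_exact:
  assumes ex: "exact_seq ([C, B, A], [g, f])" and comm: "comm_group A" "comm_group B" "comm_group C"
    and A: "rank_on A (carrier A) a" and C: "rank_on C (carrier C) c"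
  obtains b where "rank_on B (carrier B) b" "b \<le> a + c"
proof -
  have f: "f \<in> hom A B" and g: "g \<in> hom B C" and ker: "kernel B C g = f ` carrier A"
    using ex by (auto simp: group_hom_def group_hom_axioms_def)
  obtain k m where m: "rank_on B (f ` carrier A) m" "a = k + m"
    using rank_on_kernel_image[OF comm(1,2) f A] by blast
  have "g ` carrier B \<subseteq> carrier C"
    using g by (auto simp: hom_def)
  then obtain l where l: "rank_on C (g ` carrier B) l" "l \<le> c"
    using comm_group.rank_on_subset[OF comm(3) C] by blast
  have "rank_on B (carrier B) (m + l)"
    using rank_nullity[OF comm(2,3) g _ l(1)] m(1) unfolding ker by blast
  moreover have "m + l \<le> a + c"
    using m(2) l(2) by simp
  ultimately show thesis
    by (rule that)
qed

lemma homology_rank_iso: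
  assumes "f \<in> iso (relative_homology_group p X S) (relative_homology_group p Y T)" "homology_rank p X S n"
  shows "homology_rank p Y T n"
proof -
  have "f \<in> hom (relative_homology_group p X S) (relative_homology_group p Y T)"
    using assms(1) by (simp add: iso_def)
  then show ?thesis
    using rank_on_iso[OF abelian_relative_homology_group abelian_relative_homology_group _ assms] by blast
qed

lemma homology_rank_trivial: "trivial_group (relative_homology_group p X S) \<Longrightarrow> homology_rank p X S 0"
  by (rule comm_group.rank_on_trivial_group[OF abelian_relative_homology_group])

lemma finite_type_homology_trivial:
  "(\<And>p. trivial_group (relative_homology_group p X S)) \<Longrightarrow> finite_type_homology X S"
  unfolding finite_type_homology_def using homology_rank_trivial by blast

lemma finite_type_homology_iso:
  assumes "finite_type_homology X S"
    and "\<And>p. f p \<in> iso (relative_homology_group p X S) (relative_homology_group p Y T)"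
  shows "finite_type_homology Y T"
  using assms homology_rank_iso unfolding finite_type_homology_def by metis

lemma finite_type_homology_triple:
  assumes "T \<subseteq> S" "finite_type_homology (subtopology X S) T" "finite_type_homology X S"
  shows "finite_type_homology X T"
proof -
  have le: "\<exists>b. homology_rank p X T b \<and> b \<le> a + c"
    if "homology_rank p (subtopology X S) T a" "homology_rank p X S c" for p a c
    using rank_on_exact[OF homology_exactness_triple_3[OF assms(1)] abelian_relative_homology_group
        abelian_relative_homology_group abelian_relative_homology_group that] by blast
  obtain M N where "\<forall>p\<ge>M. homology_rank p (subtopology X S) T 0" "\<forall>p\<ge>N. homology_rank p X S 0"
    using assms unfolding finite_type_homology_def by blast
  then have "\<forall>p\<ge>max M N. homology_rank p X T 0"
    using le[of _ 0 0] by fastforce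
  moreover have "\<exists>n. homology_rank p X T n" for p
    using assms le unfolding finite_type_homology_def by metis
  ultimately show ?thesis
    unfolding finite_type_homology_def by blast
qed

lemma finite_type_homology_triple_quotient:
  assumes "T \<subseteq> S" "finite_type_homology X T" "finite_type_homology (subtopology X S) T"
  shows "finite_type_homology X S"
proof -
  have le: "\<exists>b. homology_rank p X S b \<and> b \<le> a + c"
    if "homology_rank p X T a" "homology_rank (p - 1) (subtopology X S) T c" for p a c
    using rank_on_exact[OF homology_exactness_triple_1[OF assms(1)] abelian_relative_homology_group
        abelian_relative_homology_group abelian_relative_homology_group that] by blast
  obtain M N where MN: "\<forall>p\<ge>M. homology_rank p (subtopology X S) T 0" "\<forall>p\<ge>N. homology_rank p X T 0"
    using assms unfolding finite_type_homology_def by blast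
  \<comment> \<open>The \<open>+ 1\<close> accounts for the connecting homomorphism, which lands in
    degree \<open>p - 1\<close> of the pair of \<open>S\<close> and \<open>T\<close>.\<close>
  have "homology_rank p X S 0" if "p \<ge> max (M + 1) N" for p
  proof -
    have "p - 1 \<ge> M" "p \<ge> N"
      using that by auto
    then show ?thesis
      using le[of p 0 0] MN by fastforce
  qed
  moreover have "\<exists>n. homology_rank p X S n" for p
    using assms le unfolding finite_type_homology_def by metis
  ultimately show ?thesis
    unfolding finite_type_homology_def by blast
qed

lemma rank_on_integer_group: "rank_on integer_group (carrier integer_group) 1"
proof -
  interpret comm_group integer_group
    by (rule abelian_integer_group)
  have lin: "lincomb integer_group c {1} = c 1" for c
    using lincomb_insert[of "{}" 1 c] lincomb_def[of integer_group c "{}"] by simp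
  have "indep integer_group {1}"
    unfolding indep_def by (simp add: lin)
  moreover have "depends_on integer_group {1} g" for g
    unfolding depends_on_def by (intro exI[of _ 1] exI[of _ "\<lambda>_. g"]) (simp add: lin)
  ultimately show ?thesis
    unfolding rank_on_def by (intro exI[of _ "{1}"]) simp
qed

lemma finite_type_homology_singleton:
  assumes "topspace X = {a}"
  shows "finite_type_homology X {}"
proof -
  have triv: "homology_rank p X {} 0" if "p \<noteq> 0" for p
    using homology_dimension_axiom[OF assms that] by (rule homology_rank_trivial)
  have "integer_group \<cong> homology_group 0 X"
    using homology_coefficients[OF assms] by (simp add: group.iso_sym)
  then obtain f where f: "f \<in> iso integer_group (homology_group 0 X)"
    by (auto simp: is_iso_def)
  then have "f \<in> hom integer_group (homology_group 0 X)"
    by (simp add: iso_def)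
  then have "homology_rank 0 X {} 1"
    using rank_on_iso[OF abelian_integer_group abelian_relative_homology_group _ f rank_on_integer_group] by blast
  then have "\<exists>n. homology_rank p X {} n" for p
    using triv by (cases "p = 0") auto
  moreover have "\<forall>p\<ge>1. homology_rank p X {} 0"
    using triv by auto
  ultimately show ?thesis
    unfolding finite_type_homology_def by blast
qed

text \<open>With \<open>m\<close> closed and \<open>W\<close> its least neighbourhood, ordinary
  excision of \<open>topspace X - W\<close> compares the pair of \<open>X\<close> and
  \<open>X - {m}\<close> with that of \<open>W\<close> and \<open>W - {m}\<close>. Here
  \<open>W\<close> has the homology of the point \<open>m\<close>, and both complements of
  \<open>m\<close> are smaller spaces.\<close>

theorem finite_type_homology_finite_t0:
  assumes "finite (topspace X)" "t0_space X"
  shows "finite_type_homology X {}"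
  using assms
proof (induction "card (topspace X)" arbitrary: X rule: less_induct)
  case less
  show ?case
  proof (cases "topspace X = {}")
    case True
    then show ?thesis
      by (simp add: finite_type_homology_trivial trivial_homology_group_empty)
  next
    case False
    then obtain m where m: "m \<in> topspace X" "closedin X {m}"
      using finite_t0_closed_point[OF less.prems] by blast
    obtain W where W: "openin X W" "m \<in> W" and Wmin: "\<And>U. \<lbrakk>openin X U; m \<in> U\<rbrakk> \<Longrightarrow> W \<subseteq> U"
      using finite_minimal_open_neighbourhood[OF less.prems(1) m(1)] by blast
    have WX: "W \<subseteq> topspace X"
      using W(1) by (rule openin_subset)
    have sub: "finite_type_homology (subtopology X Y) {}" if "topspace X \<inter> Y \<subset> topspace X" for Y
    proof (rule less.hyps)
      show "card (topspace (subtopology X Y)) < card (topspace X)"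
        using that less.prems(1) by (simp add: psubset_card_mono)
      show "finite (topspace (subtopology X Y))"
        using less.prems(1) by simp
      show "t0_space (subtopology X Y)"
        using less.prems(2) by (rule t0_space_subtopology)
    qed
    let ?W = "subtopology X W" and ?U = "topspace X - {m}"
    have tW: "topspace ?W = W"
      using WX by auto
    have WminW: "U = topspace ?W" if "openin ?W U" "m \<in> U" for U
    proof -
      have "openin X U" "U \<subseteq> W"
        using that(1) W(1) by (simp_all add: openin_open_subtopology)
      then show ?thesis
        using Wmin[OF _ that(2)] unfolding tW by blast
    qed
    have mW: "m \<in> topspace ?W"
      using W(2) WX by auto
    have "finite_type_homology ?W {m}"
      by (rule finite_type_homology_trivial, rule trivial_relative_homology_group_minimum[OF mW _ WminW])
         simp
    moreover have "finite_type_homology (subtopology ?W {m}) {}"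
      by (rule finite_type_homology_singleton[of _ m]) (use W(2) WX in auto)
    ultimately have W0: "finite_type_homology ?W {}"
      by (rule finite_type_homology_triple[OF empty_subsetI, rotated])
    have "finite_type_homology (subtopology ?W (W - {m})) {}"
      unfolding subtopology_subtopology using m(1) by (intro sub) blast
    then have W1: "finite_type_homology ?W (W - {m})"
      using W0 by (rule finite_type_homology_triple_quotient[OF empty_subsetI, rotated])
    have "openin X ?U"
      using m(2) by blast
    have "closedin X (topspace X - W)"
      using W(1) by blast
    then have cl: "X closure_of (topspace X - W) \<subseteq> X interior_of ?U"
      using W(2) \<open>openin X ?U\<close> by (simp add: closure_of_closedin interior_of_openin) blast
    have eq: "topspace X - (topspace X - W) = W" "?U - (topspace X - W) = W - {m}"
      using WX by auto
    have "finite_type_homology X ?U"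
      by (rule finite_type_homology_iso[OF W1])
         (use homology_excision_axiom[OF cl, of "topspace X"] in \<open>simp add: eq\<close>)
    moreover have "finite_type_homology (subtopology X ?U) {}"
      using m(1) by (intro sub) blast
    ultimately show ?thesis
      by (rule finite_type_homology_triple[OF empty_subsetI, rotated])
  qed
qed

text \<open>\<open>q i\<close> is the rank of the image of the connecting homomorphism in \<open>H\<^sub>i(A)\<close>.\<close>

lemma long_exact_rank:
  assumes X: "finite_type_homology X {}" and A: "finite_type_homology (subtopology X A) {}"
  obtains q :: "nat \<Rightarrow> nat" and N where "\<forall>i\<ge>N. q i = 0"
    "\<forall>i. ab_rank (homology_group (int i) (subtopology X A)) + ab_rank (relative_homology_group (int i) X A)
       = ab_rank (homology_group (int i) X) + q i + (if i = 0 then 0 else q (i - 1))"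
    "\<forall>i. trivial_homomorphism (relative_homology_group (int i + 1) X A)
            (homology_group (int i) (subtopology X A)) (hom_boundary (int i + 1) X A) \<longrightarrow> q i = 0"
proof -
  let ?A = "\<lambda>p. homology_group p (subtopology X A)" and ?X = "\<lambda>p. homology_group p X"
    and ?R = "\<lambda>p. relative_homology_group p X A"
  let ?i = "\<lambda>p. hom_induced p (subtopology X A) {} X {} id" and ?j = "\<lambda>p. hom_induced p X {} X A id"
    and ?d = "\<lambda>p. hom_boundary p X A"
  let ?im = "\<lambda>p. ?d (p + 1) ` carrier (?R (p + 1))"
  have R: "finite_type_homology X A"
    using finite_type_homology_triple_quotient[OF empty_subsetI X A] .
  have hom: "?i p \<in> hom (?A p) (?X p)" "?j p \<in> hom (?X p) (?R p)" "?d p \<in> hom (?R p) (?A (p - 1))" for p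
    by (simp_all add: hom_induced_hom hom_boundary_hom)
  note comm = abelian_relative_homology_group
  have kd: "kernel (?R p) (?A (p - 1)) (?d p) = ?j p ` carrier (?X p)" for p
    using homology_exactness_axiom_1[of p X A] by simp
  have ki: "kernel (?A p) (?X p) (?i p) = ?im p" for p
    using homology_exactness_axiom_2[of "p + 1" X A] by simp
  have kj: "kernel (?X p) (?R p) (?j p) = ?i p ` carrier (?A p)" for p
    using homology_exactness_axiom_3[of p X A] by simp
  have im_sub: "?im p \<subseteq> carrier (?A p)" for p
    using ki[of p] by (auto simp: kernel_def)
  have "\<exists>n. rank_on (?A p) (?im p) n" for p
  proof -
    obtain a where "homology_rank p (subtopology X A) {} a"
      using A unfolding finite_type_homology_def by blast
    then show ?thesis
      using comm_group.rank_on_subset[OF comm _ im_sub order_refl] by blast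
  qed
  then obtain Q where Q: "\<And>p. rank_on (?A p) (?im p) (Q p)"
    by metis
  have Q0: "Q p = 0" if "homology_rank p (subtopology X A) {} 0" for p
    using comm_group.rank_on_subset[OF comm that im_sub order_refl] comm_group.rank_on_unique[OF comm Q]
    by (metis le_zero_eq)
  have count: "a + r = x + Q p + Q (p - 1)"
    if ranks: "homology_rank p (subtopology X A) {} a" "homology_rank p X A r" "homology_rank p X {} x" for p a r x
  proof -
    obtain k m where km: "rank_on (?A p) (kernel (?A p) (?X p) (?i p)) k" "rank_on (?X p) (?i p ` carrier (?A p)) m"
        "a = k + m"
      using rank_on_kernel_image[OF comm comm hom(1) ranks(1)] by blast
    obtain k' m' where km': "rank_on (?X p) (kernel (?X p) (?R p) (?j p)) k'" "rank_on (?R p) (?j p ` carrier (?X p)) m'"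
        "x = k' + m'"
      using rank_on_kernel_image[OF comm comm hom(2) ranks(3)] by blast
    obtain k'' m'' where km'': "rank_on (?R p) (kernel (?R p) (?A (p - 1)) (?d p)) k''"
        "rank_on (?A (p - 1)) (?d p ` carrier (?R p)) m''" "r = k'' + m''"
      using rank_on_kernel_image[OF comm comm hom(3) ranks(2)] by blast
    \<comment> \<open>Exactness matches each image with the next kernel, giving
      \<open>a = Q p + m\<close>, \<open>x = m + m'\<close> and
      \<open>r = m' + Q (p - 1)\<close>.\<close>
    have "k = Q p"
      using km(1) Q[of p] unfolding ki by (rule comm_group.rank_on_unique[OF comm])
    moreover have "k' = m"
      using km'(1) km(2) unfolding kj by (rule comm_group.rank_on_unique[OF comm])
    moreover have "k'' = m'"
      using km''(1) km'(2) unfolding kd by (rule comm_group.rank_on_unique[OF comm])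
    moreover have "m'' = Q (p - 1)"
      using km''(2) Q[of "p - 1"] by (simp add: comm_group.rank_on_unique[OF comm])
    ultimately show ?thesis
      using km(3) km'(3) km''(3) by simp
  qed
  obtain M where M: "\<And>p. p \<ge> M \<Longrightarrow> homology_rank p (subtopology X A) {} 0"
    using A unfolding finite_type_homology_def by blast
  show thesis
  proof (rule that[of "nat M" "\<lambda>i. Q (int i)"]; intro allI impI)
    fix i
    show "Q (int i) = 0" if "i \<ge> nat M"
      using that by (intro Q0 M) simp
    obtain a r x where ranks: "homology_rank (int i) (subtopology X A) {} a" "homology_rank (int i) X A r"
        "homology_rank (int i) X {} x"
      using A R X unfolding finite_type_homology_def by blast
    \<comment> \<open>In degree 0 the connecting homomorphism ends in degree -1, where homology is
      trivial; this is the case \<open>i = 0\<close> of the last summand.\<close>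
    have "Q (- 1) = 0"
      by (intro Q0 homology_rank_trivial) simp
    then have "Q (int i - 1) = (if i = 0 then 0 else Q (int (i - 1)))"
      by (cases i) auto
    then show "ab_rank (?A (int i)) + ab_rank (?R (int i))
       = ab_rank (?X (int i)) + Q (int i) + (if i = 0 then 0 else Q (int (i - 1)))"
      using count[OF ranks] ranks[THEN comm_group.ab_rank_eqI[OF comm]] by simp
    show "Q (int i) = 0" if triv: "trivial_homomorphism (?R (int i + 1)) (?A (int i)) (?d (int i + 1))"
    proof -
      have "\<one>\<^bsub>?R (int i + 1)\<^esub> \<in> carrier (?R (int i + 1))"
        by (simp add: group.is_monoid)
      then have "?im (int i) = {\<one>\<^bsub>?A (int i)\<^esub>}"
        using triv by (auto simp: trivial_homomorphism_def)
      then show ?thesis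
        using Q[of "int i"] comm_group.rank_on_one[OF comm] comm_group.rank_on_unique[OF comm] by metis
    qed
  qed
qed

section \<open>Essential solutions and the dual repeller\<close>

text \<open>A finite union of point closures is closed. Closedness thus becomes a one-step
  condition, directly comparable with \<open>Pi_pt\<close>.\<close>

lemma closedin_finite_iff:
  assumes "finite (topspace X)" "N \<subseteq> topspace X"
  shows "closedin X N \<longleftrightarrow> (\<forall>x\<in>N. X closure_of {x} \<subseteq> N)"
proof
  assume "closedin X N"
  then show "\<forall>x\<in>N. X closure_of {x} \<subseteq> N"
    by (simp add: closure_of_minimal)
next
  assume R: "\<forall>x\<in>N. X closure_of {x} \<subseteq> N"
  have "N = (\<Union>x\<in>N. X closure_of {x})"
  proof
    show "N \<subseteq> (\<Union>x\<in>N. X closure_of {x})"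
    proof
      fix x assume "x \<in> N"
      moreover have "x \<in> X closure_of {x}"
        using closure_of_subset[of "{x}" X] \<open>x \<in> N\<close> assms(2) by blast
      ultimately show "x \<in> (\<Union>x\<in>N. X closure_of {x})"
        by blast
    qed
  qed (use R in blast)
  moreover have "closedin X (\<Union>x\<in>N. X closure_of {x})"
    using assms by (intro closedin_Union) (auto intro: finite_subset)
  ultimately show "closedin X N"
    by simp
qed

text \<open>Join a path from \<open>x\<close> to \<open>y\<close> with one back and run through the
  loop forever in both directions, reading indices modulo its length \<open>p\<close>.\<close>

lemma relpow_periodic_path:
  assumes xy: "(x, y) \<in> R\<^sup>*" and yx: "(y, x) \<in> R\<^sup>*" and "x \<noteq> y"
  obtains \<phi> :: "int \<Rightarrow> 'a" where "\<phi> 0 = x" "\<And>i. (\<phi> i, \<phi> (i + 1)) \<in> R"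
    "\<And>n. \<exists>s\<le>n. \<phi> s = x" "\<And>n. \<exists>s\<ge>n. \<phi> s = x" "\<And>n. \<exists>s\<le>n. \<phi> s = y" "\<And>n. \<exists>s\<ge>n. \<phi> s = y"
proof -
  obtain m n where m: "(x, y) \<in> R ^^ m" and n: "(y, x) \<in> R ^^ n"
    using xy yx by (metis rtrancl_imp_relpow)
  obtain f g where f: "f 0 = x" "f m = y" "\<And>i. i < m \<Longrightarrow> (f i, f (Suc i)) \<in> R"
    and g: "g 0 = y" "g n = x" "\<And>i. i < n \<Longrightarrow> (g i, g (Suc i)) \<in> R"
    using m n unfolding relpow_fun_conv by auto
  have mn: "m > 0" "n > 0"
    using m n \<open>x \<noteq> y\<close> by (auto intro: gr0I)
  define h where "h i = (if i \<le> m then f i else g (i - m))" for i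
  define p where "p = int (m + n)"
  have p: "p > 0" "int m < p"
    using mn by (auto simp: p_def)
  have h: "h 0 = x" "h m = y" "h (m + n) = x" "(h i, h (Suc i)) \<in> R" if "i < m + n" for i
  proof -
    show "(h i, h (Suc i)) \<in> R"
    proof (cases "i < m")
      case False
      then have "g (i - m) = h i"
        using f(2) g(1) by (auto simp: h_def)
      moreover have "h (Suc i) = g (Suc (i - m))"
        using False by (simp add: h_def Suc_diff_le)
      ultimately show ?thesis
        using g(3)[of "i - m"] False that by simp
    qed (use f in \<open>simp add: h_def\<close>)
  qed (use f g mn in \<open>auto simp: h_def\<close>)
  define \<phi> where "\<phi> i = h (nat (i mod p))" for i
  have per: "\<phi> (i + p * k) = \<phi> i" for i k
    by (simp add: \<phi>_def)
  have step: "(\<phi> i, \<phi> (i + 1)) \<in> R" for i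
  proof -
    have r: "0 \<le> i mod p" "i mod p < p"
      using p by auto
    have lt: "nat (i mod p) < m + n"
      using r by (simp add: p_def nat_less_iff)
    show ?thesis
    proof (cases "i mod p + 1 = p")
      \<comment> \<open>The index wraps round here; the loop closes because \<open>h (m + n)\<close>
        and \<open>h 0\<close> are both \<open>x\<close>.\<close>
      case True
      have "(i + 1) mod p = 0"
        using mod_add_left_eq[of i p 1] True by simp
      moreover have "Suc (nat (i mod p)) = m + n"
        using True r by (simp add: p_def)
      ultimately show ?thesis
        using h(4)[OF lt] h(1,3)[OF lt] by (simp add: \<phi>_def)
    next
      case False
      then have "(i mod p + 1) mod p = i mod p + 1"
        using r by (intro mod_pos_pos_trivial) auto
      then have "(i + 1) mod p = i mod p + 1"
        by (simp only: mod_add_left_eq)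
      then have "nat ((i + 1) mod p) = Suc (nat (i mod p))"
        using r by simp
      then show ?thesis
        using h(4)[OF lt] by (simp add: \<phi>_def)
    qed
  qed
  have lt: "0 < m + n"
    using mn by simp
  have val: "\<phi> 0 = x" "\<phi> (int m) = y"
    using h(1,2)[OF lt] p by (simp_all add: \<phi>_def)
  have below: "\<exists>s\<le>n. \<phi> s = \<phi> c" and above: "\<exists>s\<ge>n. \<phi> s = \<phi> c" for n c
  proof -
    \<comment> \<open>Since \<open>p\<close> is at least 1, shifting \<open>c\<close> by that many
      periods passes \<open>n\<close> in either direction.\<close>
    have ge: "\<bar>n - c\<bar> \<le> p * \<bar>n - c\<bar>"
      using p mult_right_mono[of 1 p "\<bar>n - c\<bar>"] by simp
    show "\<exists>s\<le>n. \<phi> s = \<phi> c"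
      by (rule exI[of _ "c + p * (- \<bar>n - c\<bar>)"]) (use ge in \<open>simp only: per, auto\<close>)
    show "\<exists>s\<ge>n. \<phi> s = \<phi> c"
      by (rule exI[of _ "c + p * \<bar>n - c\<bar>"]) (use ge in \<open>simp only: per, auto\<close>)
  qed
  show thesis
    by (rule that[of \<phi>]) (use val step below[of _ 0] above[of _ 0] below[of _ "int m"] above[of _ "int m"] in auto)
qed

lemma V_hull_subset:
  "\<lbrakk>B \<subseteq> topspace X; compatible X V B; locally_closed_in X B; Z \<subseteq> B\<rbrakk> \<Longrightarrow> V_hull X V Z \<subseteq> B"
  unfolding V_hull_def by blast

section \<open>Essential solutions of a multivector field on a finite space\<close>

locale finite_mvf =
  fixes X :: "'a topology" and V :: "'a set set"
  assumes finite_X: "finite (topspace X)" and t0_X: "t0_space X" and mvf: "multivector_field X V"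
begin

lemma cell_eq: "\<lbrakk>W \<in> V; x \<in> W\<rbrakk> \<Longrightarrow> cell V x = W"
  unfolding cell_def using mvf unfolding multivector_field_def by (intro the_equality) blast+

lemma
  assumes "x \<in> topspace X"
  shows cell_in: "cell V x \<in> V" and in_cell: "x \<in> cell V x" and cell_subset: "cell V x \<subseteq> topspace X"
proof -
  have "x \<in> \<Union>V"
    using assms mvf unfolding multivector_field_def by simp
  then obtain W where W: "W \<in> V" "x \<in> W"
    by blast
  then show "cell V x \<in> V" "x \<in> cell V x" "cell V x \<subseteq> topspace X"
    using cell_eq[OF W] mvf unfolding multivector_field_def by auto
qed

lemma cell_eq_cell: "\<lbrakk>x \<in> topspace X; y \<in> cell V x\<rbrakk> \<Longrightarrow> cell V y = cell V x"
  using cell_in cell_eq by blast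

lemma compatible_cell_subset: "\<lbrakk>compatible X V A; x \<in> A; x \<in> topspace X\<rbrakk> \<Longrightarrow> cell V x \<subseteq> A"
  unfolding compatible_def using in_cell by blast

lemma compatibleI:
  assumes "A \<subseteq> topspace X" "\<And>x. x \<in> A \<Longrightarrow> cell V x \<subseteq> A"
  shows "compatible X V A"
  unfolding compatible_def
proof
  fix x assume x: "x \<in> topspace X"
  show "cell V x \<inter> A = {} \<or> cell V x \<subseteq> A"
    using assms cell_eq_cell[OF x] by blast
qed

text \<open>It suffices to leave the multivector of \<open>\<phi> t\<close> once before and once after \<open>t\<close>: at a later visit of
  the same multivector the condition applies again.\<close>

lemma essential_iff:
  "essential X V \<phi> \<longleftrightarrow> full_solution X V \<phi> \<and>
     (\<forall>t. regular X (cell V (\<phi> t)) \<longrightarrow> (\<exists>s\<le>t. \<phi> s \<notin> cell V (\<phi> t)) \<and> (\<exists>s\<ge>t. \<phi> s \<notin> cell V (\<phi> t)))"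
  (is "_ \<longleftrightarrow> _ \<and> ?R")
proof
  assume "essential X V \<phi>"
  then show "full_solution X V \<phi> \<and> ?R"
    unfolding essential_def by blast
next
  assume R: "full_solution X V \<phi> \<and> ?R"
  then have T: "\<phi> t \<in> topspace X" for t
    unfolding full_solution_def by blast
  show "essential X V \<phi>"
    unfolding essential_def
  proof (intro conjI allI impI)
    fix t n assume t: "regular X (cell V (\<phi> t))"
    have eq: "cell V (\<phi> n) = cell V (\<phi> t)" if "\<phi> n \<in> cell V (\<phi> t)"
      using that cell_eq_cell T by blast
    show "\<exists>s\<le>n. \<phi> s \<notin> cell V (\<phi> t)"
      using R t eq by (metis order_refl)
    show "\<exists>s\<ge>n. \<phi> s \<notin> cell V (\<phi> t)"
      using R t eq by (metis order_refl)
  qed (use R in blast)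
qed

lemma essential_in_topspace: "essential X V \<phi> \<Longrightarrow> \<phi> i \<in> topspace X"
  unfolding essential_def full_solution_def by blast

lemma essential_step: "essential X V \<phi> \<Longrightarrow> \<phi> (i + 1) \<in> Pi_pt X V (\<phi> i)"
  unfolding essential_def full_solution_def by blast

lemma InvI: "\<lbrakk>essential X V \<phi>; range \<phi> \<subseteq> Y; \<phi> 0 = x\<rbrakk> \<Longrightarrow> x \<in> Inv X V Y"
  unfolding Inv_def by blast

lemma InvE:
  assumes "x \<in> Inv X V Y"
  obtains \<phi> where "essential X V \<phi>" "range \<phi> \<subseteq> Y" "\<phi> 0 = x"
  using assms unfolding Inv_def by blast

text \<open>Leaving a multivector in the past depends only on \<open>\<psi>\<close>, leaving it in
  the future only on \<open>\<rho>\<close>, so the past of one may be glued to the future of the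
  other.\<close>

lemma essential_concat:
  assumes \<psi>: "essential X V \<psi>" and \<rho>: "essential X V \<rho>" and step: "\<rho> 0 \<in> Pi_pt X V (\<psi> 0)"
  shows "essential X V (\<lambda>i. if i \<le> 0 then \<psi> i else \<rho> (i - 1))" (is "essential X V ?\<phi>")
  unfolding essential_iff
proof (intro conjI allI impI)
  have "?\<phi> (i + 1) \<in> Pi_pt X V (?\<phi> i)" for i
  proof -
    consider "i < 0" | "i = 0" | "i > 0" by linarith
    then show ?thesis
      using essential_step[OF \<psi>, of i] essential_step[OF \<rho>, of "i - 1"] step by cases auto
  qed
  then show "full_solution X V ?\<phi>"
    using \<psi> \<rho> unfolding full_solution_def by (auto simp: essential_in_topspace)
  fix t assume reg: "regular X (cell V (?\<phi> t))"
  let ?C = "cell V (?\<phi> t)"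
  have T: "?\<phi> t \<in> topspace X"
    using \<psi> \<rho> by (simp add: essential_in_topspace)
  \<comment> \<open>The multivector may be one visited by \<open>\<rho>\<close>. Either
    \<open>\<psi> r\<close> is already outside it, or it is also the multivector of
    \<open>\<psi> r\<close> and \<open>\<psi>\<close> must have left it earlier.\<close>
  have past: "\<exists>s\<le>r. \<psi> s \<notin> ?C" for r
  proof (cases "\<psi> r \<in> ?C")
    case True
    then have "cell V (\<psi> r) = ?C"
      using T by (rule_tac cell_eq_cell)
    then show ?thesis
      using \<psi> reg unfolding essential_iff by metis
  qed blast
  have forth: "\<exists>s\<ge>r. \<rho> s \<notin> ?C" for r
  proof (cases "\<rho> r \<in> ?C")
    case True
    then have "cell V (\<rho> r) = ?C"
      using T by (rule_tac cell_eq_cell)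
    then show ?thesis
      using \<rho> reg unfolding essential_iff by metis
  qed blast
  \<comment> \<open>The bounds keep \<open>a\<close> in the \<open>\<psi>\<close> part; time
    \<open>b\<close> of \<open>\<rho>\<close> is time \<open>b + 1\<close> of the glued map, since
    \<open>\<rho>\<close> is entered at time 1.\<close>
  obtain a b where a: "a \<le> min t 0" "\<psi> a \<notin> ?C" and b: "b \<ge> max t 0" "\<rho> b \<notin> ?C"
    using past forth by blast
  show "\<exists>s\<le>t. ?\<phi> s \<notin> ?C"
    using a by (intro exI[of _ a]) auto
  show "\<exists>s\<ge>t. ?\<phi> s \<notin> ?C"
    using b by (intro exI[of _ "b + 1"]) auto
qed

definition reach :: "'a set \<Rightarrow> ('a \<times> 'a) set" where
  "reach Y = {(x, y). x \<in> Y \<and> y \<in> Y \<and> y \<in> Pi_pt X V x}"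

lemma Inv_critical:
  assumes "x \<in> Y" "x \<in> topspace X" "\<not> regular X (cell V x)"
  shows "x \<in> Inv X V Y"
proof (rule InvI[of "\<lambda>_. x"])
  show "essential X V (\<lambda>_. x)"
    using assms in_cell unfolding essential_def full_solution_def Pi_pt_def by auto
qed (use assms in auto)

text \<open>The periodic solution through \<open>x\<close> and \<open>y\<close> meets two different
  multivectors at arbitrarily early and late times, so it stays in none.\<close>

lemma Inv_recurrent:
  assumes Y: "Y \<subseteq> topspace X" and x: "x \<in> Y" and xy: "(x, y) \<in> (reach Y)\<^sup>*" "(y, x) \<in> (reach Y)\<^sup>*"
    and ne: "cell V x \<noteq> cell V y"
  shows "x \<in> Inv X V Y"
proof -
  obtain \<phi> :: "int \<Rightarrow> 'a" where \<phi>: "\<phi> 0 = x" "\<And>i. (\<phi> i, \<phi> (i + 1)) \<in> reach Y"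
    "\<And>n. \<exists>s\<le>n. \<phi> s = x" "\<And>n. \<exists>s\<ge>n. \<phi> s = x" "\<And>n. \<exists>s\<le>n. \<phi> s = y" "\<And>n. \<exists>s\<ge>n. \<phi> s = y"
    using relpow_periodic_path[OF xy] ne by metis
  have ran: "\<phi> i \<in> Y" "\<phi> (i + 1) \<in> Pi_pt X V (\<phi> i)" for i
    using \<phi>(2)[of i] unfolding reach_def by auto
  have "essential X V \<phi>"
    unfolding essential_def
  proof (intro conjI allI impI)
    show "full_solution X V \<phi>"
      using ran Y unfolding full_solution_def by blast
    fix t n
    have "x \<notin> cell V (\<phi> t) \<or> y \<notin> cell V (\<phi> t)"
      using ne cell_eq_cell ran(1) Y by (metis subsetD)
    then show "\<exists>s\<le>n. \<phi> s \<notin> cell V (\<phi> t)" "\<exists>s\<ge>n. \<phi> s \<notin> cell V (\<phi> t)"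
      using \<phi>(3-6)[of n] by metis+
  qed
  then show ?thesis
    using ran(1) \<phi>(1) by (intro InvI[of \<phi>]) auto
qed

lemma reach_path:
  assumes \<phi>: "essential X V \<phi>" and Y: "\<And>i. i \<le> j \<Longrightarrow> \<phi> i \<in> Y" and "a \<le> b" "b \<le> j"
  shows "(\<phi> a, \<phi> b) \<in> (reach Y)\<^sup>*"
  using \<open>a \<le> b\<close> \<open>b \<le> j\<close>
proof (induction b rule: int_ge_induct)
  case (step i)
  then have "(\<phi> i, \<phi> (i + 1)) \<in> reach Y"
    using essential_step[OF \<phi>, of i] Y unfolding reach_def by simp
  with step show ?case
    by (simp add: rtrancl_into_rtrancl)
qed simp

end

section \<open>The attractor and its dual repeller\<close>

locale mvf_attractor = finite_mvf +
  fixes A :: "'a set"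
  assumes inv_X: "invariant X V (topspace X)" and A_sub: "A \<subseteq> topspace X" and A_attr: "attractor X V A"
begin

abbreviation "R \<equiv> Inv X V (topspace X - A)"

lemma A_Pi: "x \<in> A \<Longrightarrow> Pi_pt X V x \<subseteq> A"
  using A_attr unfolding attractor_def Pi_set_def by blast

lemma A_closed: "closedin X A"
  unfolding closedin_finite_iff[OF finite_X A_sub] using A_Pi unfolding Pi_pt_def cl_def by blast

lemma A_compatible: "compatible X V A"
  using A_sub A_Pi unfolding Pi_pt_def by (intro compatibleI) auto

lemma essential_through:
  assumes "x \<in> topspace X"
  obtains \<phi> where "essential X V \<phi>" "\<phi> 0 = x"
  using assms inv_X unfolding invariant_def by (metis InvE)

lemma attractor_forward:
  assumes \<phi>: "essential X V \<phi>" and "\<phi> i \<in> A" "i \<le> j"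
  shows "\<phi> j \<in> A"
  using \<open>i \<le> j\<close>
proof (induction j rule: int_ge_induct)
  case (step j)
  then show ?case
    using essential_step[OF \<phi>, of j] A_Pi by blast
qed (use assms in simp)

lemma R_sub: "R \<subseteq> topspace X - A"
  unfolding Inv_def by blast

text \<open>Since \<open>A\<close> is forward stable, \<open>y\<close> is outside \<open>A\<close>,
  and so is the past of any essential solution through \<open>y\<close>; glue this past to the
  future of \<open>x\<close> that avoids \<open>A\<close>. The closure part of \<open>Pi_pt\<close>
  then makes \<open>R\<close> open, the multivector part makes it compatible.\<close>

lemma R_backward:
  assumes x: "x \<in> R" and y: "y \<in> topspace X" and xy: "x \<in> Pi_pt X V y"
  shows "y \<in> R"
proof -
  have "y \<notin> A"
    using A_Pi xy x R_sub by blast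
  obtain \<psi> where \<psi>: "essential X V \<psi>" "\<psi> 0 = y"
    using essential_through[OF y] .
  obtain \<rho> where \<rho>: "essential X V \<rho>" "range \<rho> \<subseteq> topspace X - A" "\<rho> 0 = x"
    using x by (rule InvE)
  have past: "\<psi> i \<in> topspace X - A" if "i \<le> 0" for i
    using attractor_forward[OF \<psi>(1) _ that] \<psi> \<open>y \<notin> A\<close> essential_in_topspace by auto
  show ?thesis
    by (rule InvI[OF essential_concat[OF \<psi>(1) \<rho>(1)]]) (use \<rho> \<psi>(2) xy past in auto)
qed

abbreviation "N \<equiv> topspace X - R"

lemma N_closed: "closedin X N"
proof -
  have "X closure_of {y} \<subseteq> N" if "y \<in> N" for y
    using R_backward[of _ y] that closure_of_subset_topspace[of X "{y}"] unfolding Pi_pt_def cl_def by blast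
  then show ?thesis
    by (simp add: closedin_finite_iff finite_X)
qed

lemma R_open: "openin X R"
  using N_closed R_sub by (simp add: openin_closedin_eq subset_iff)

lemma R_compatible: "compatible X V R"
proof (rule compatibleI)
  fix x assume x: "x \<in> R"
  then have xT: "x \<in> topspace X"
    using R_sub by blast
  show "cell V x \<subseteq> R"
  proof
    fix y assume y: "y \<in> cell V x"
    then show "y \<in> R"
      using R_backward[OF x, of y] cell_eq_cell[OF xT y] in_cell[OF xT] cell_subset[OF xT] unfolding Pi_pt_def by blast
  qed
qed (use R_sub in blast)

text \<open>Up to time \<open>j\<close> the solution avoids \<open>A\<close>, and from time
  \<open>k\<close> on it stays in \<open>A\<close>. A point recurring in the past lies in
  \<open>R\<close>: either its multivector is critical, or the solution leaves that multivector
  between two visits and recurrence applies. As \<open>R\<close> and \<open>A\<close> are compatible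
  and locally closed, the hulls stay inside them.\<close>

lemma connection_setI:
  assumes \<phi>: "essential X V \<phi>" and k: "\<phi> k \<in> A" and j: "\<phi> j \<notin> A"
  shows "\<phi> 0 \<in> connection_set X V R A"
proof -
  have past: "\<phi> i \<in> topspace X - A" if "i \<le> j" for i
    using attractor_forward[OF \<phi> _ that] j \<phi> essential_in_topspace by auto
  have "uim_minus \<phi> \<subseteq> R"
  proof
    fix y assume y: "y \<in> uim_minus \<phi>"
    have visit: "\<exists>s\<le>t. \<phi> s = y" if "t \<le> 0" for t
      using y that unfolding uim_minus_def by blast
    obtain s2 where s2: "s2 \<le> min 0 j" "\<phi> s2 = y"
      using visit by (meson min.cobounded1)
    then have yY: "y \<in> topspace X - A"
      using past[of s2] by auto
    show "y \<in> R"
    proof (cases "regular X (cell V y)")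
      case False
      then show ?thesis
        using Inv_critical yY by blast
    next
      case True
      then obtain s' where s': "s' \<le> s2" "\<phi> s' \<notin> cell V y"
        using \<phi> s2 unfolding essential_iff by blast
      obtain s1 where s1: "s1 \<le> min 0 s'" "\<phi> s1 = y"
        using visit by (meson min.cobounded1)
      have le: "s1 \<le> s'" "s' \<le> j" "s2 \<le> j"
        using s1(1) s2(1) s'(1) by auto
      have "(\<phi> s1, \<phi> s') \<in> (reach (topspace X - A))\<^sup>*"
        by (rule reach_path[OF \<phi> past le(1,2)])
      moreover have "(\<phi> s', \<phi> s2) \<in> (reach (topspace X - A))\<^sup>*"
        by (rule reach_path[OF \<phi> past s'(1) le(3)])
      moreover have "cell V y \<noteq> cell V (\<phi> s')"
        using s'(2) in_cell[OF essential_in_topspace[OF \<phi>]] by metis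
      ultimately show ?thesis
        using Inv_recurrent[of "topspace X - A" y "\<phi> s'"] yY s1(2) s2(2) by auto
    qed
  qed
  moreover have "locally_closed_in X R"
    unfolding locally_closed_in_def using R_open R_sub by (intro exI[of _ R] exI[of _ "topspace X"]) auto
  ultimately have alpha: "alpha_lim X V \<phi> \<subseteq> R"
    unfolding alpha_lim_def using R_sub R_compatible by (intro V_hull_subset) auto
  have "uim_plus \<phi> \<subseteq> A"
  proof
    fix y assume "y \<in> uim_plus \<phi>"
    then have "y \<in> \<phi> ` {max 0 k..}"
      unfolding uim_plus_def by auto
    then show "y \<in> A"
      using attractor_forward[OF \<phi> k] by auto
  qed
  moreover have "locally_closed_in X A"
    unfolding locally_closed_in_def using A_closed A_sub by (intro exI[of _ "topspace X"] exI[of _ A]) auto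
  ultimately have "omega_lim X V \<phi> \<subseteq> A"
    unfolding omega_lim_def using A_sub A_compatible by (intro V_hull_subset) auto
  then show ?thesis
    unfolding connection_set_def using \<phi> alpha essential_in_topspace[OF \<phi>] by blast
qed

text \<open>A solution through a point outside \<open>A\<close> cannot meet \<open>A\<close>, as
  this would be a connection; so \<open>A\<close> and \<open>R\<close> cover the space. Nor can the
  closure of a point \<open>b\<close> of \<open>R\<close> meet \<open>A\<close>: a past of
  \<open>b\<close> outside \<open>A\<close>, followed by a future of the point of \<open>A\<close>,
  would be a connection. Hence \<open>R\<close> is closed.\<close>

lemma no_connection_imp_open:
  assumes "connection_set X V R A = {}"
  shows "openin X A"
proof -
  have cover: "x \<in> R" if x: "x \<in> topspace X" "x \<notin> A" for x
  proof -
    obtain \<phi> where \<phi>: "essential X V \<phi>" "\<phi> 0 = x"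
      using essential_through[OF x(1)] .
    then have "\<phi> k \<notin> A" for k
      using connection_setI[OF \<phi>(1), of k 0] assms x(2) by auto
    then show ?thesis
      using \<phi> essential_in_topspace[OF \<phi>(1)] by (intro InvI[of \<phi>]) auto
  qed
  have "X closure_of {b} \<subseteq> R" if b: "b \<in> R" for b
  proof
    fix a assume a: "a \<in> X closure_of {b}"
    then have aT: "a \<in> topspace X"
      by (meson closure_of_subset_topspace subsetD)
    show "a \<in> R"
    proof (rule ccontr)
      assume "a \<notin> R"
      then have "a \<in> A"
        using cover aT by blast
      obtain \<psi> where \<psi>: "essential X V \<psi>" "range \<psi> \<subseteq> topspace X - A" "\<psi> 0 = b"
        using b by (rule InvE)
      obtain \<rho> where \<rho>: "essential X V \<rho>" "\<rho> 0 = a"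
        using essential_through[OF aT] .
      have "\<rho> 0 \<in> Pi_pt X V (\<psi> 0)"
        using a \<rho> \<psi> by (simp add: Pi_pt_def cl_def)
      from connection_setI[OF essential_concat[OF \<psi>(1) \<rho>(1) this], of 1 0] show False
        using assms \<rho> \<psi> \<open>a \<in> A\<close> b R_sub by auto
    qed
  qed
  then have "closedin X R"
    using R_sub by (subst closedin_finite_iff[OF finite_X]) auto
  then have "openin X (topspace X - R)"
    by blast
  moreover have "topspace X - R = A"
    using cover R_sub A_sub by blast
  ultimately show ?thesis
    by simp
qed

text \<open>Outside \<open>A\<close> and its dual repeller no multivector is critical and distinct multivectors are never
  mutually reachable, because either would produce an essential solution avoiding \<open>A\<close>. So reachability
  is well-founded there, and a minimal multivector of \<open>M - A\<close> can be removed from \<open>M\<close>.\<close>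

lemma last_multivector:
  assumes M: "closedin X M" "compatible X V M" "A \<subset> M" "M \<subseteq> N"
  obtains W where "W \<in> V" "W \<noteq> {}" "W \<subseteq> M - A" "regular X W" "closedin X (M - W)" "compatible X V (M - W)"
proof -
  let ?D = "topspace X - A - R"
  have DT: "?D \<subseteq> topspace X"
    by blast
  \<comment> \<open>An essential solution inside \<open>?D\<close> avoids \<open>A\<close>, so its
    points would belong to \<open>R\<close>, which \<open>?D\<close> excludes.\<close>
  have Inv_D: "x \<notin> Inv X V ?D" if "x \<in> ?D" for x
    using that unfolding Inv_def by blast
  \<comment> \<open>\<open>Q\<close> goes from source to target, so a minimal point of
    \<open>M - A\<close> is not reachable from another multivector there. No remaining point then
    has its multivector in its closure, which is why removal leaves a closed set.\<close>
  define Q where "Q = {(y, x). y \<in> ?D \<and> x \<in> ?D \<and> (y, x) \<in> (reach ?D)\<^sup>* \<and> cell V y \<noteq> cell V x}"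
  have cellstep: "(x, y) \<in> reach ?D" if "x \<in> ?D" "y \<in> ?D" "cell V x = cell V y" for x y
    using that in_cell[of y] unfolding reach_def Pi_pt_def by auto
  have "finite Q"
    using finite_X by (intro finite_subset[of Q "topspace X \<times> topspace X"]) (auto simp: Q_def)
  have "trans Q"
  proof (rule transI)
    fix x y z assume xy: "(x, y) \<in> Q" and yz: "(y, z) \<in> Q"
    have "cell V x \<noteq> cell V z"
    proof
      assume "cell V x = cell V z"
      then have "(z, x) \<in> reach ?D"
        using xy yz by (intro cellstep) (auto simp: Q_def)
      then have "(y, x) \<in> (reach ?D)\<^sup>*"
        using yz unfolding Q_def by (blast intro: rtrancl_into_rtrancl)
      then show False
        using Inv_recurrent[OF DT, of x y] Inv_D[of x] xy unfolding Q_def by blast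
    qed
    moreover have "(x, z) \<in> (reach ?D)\<^sup>*"
      using xy yz unfolding Q_def by (blast intro: rtrancl_trans)
    ultimately show "(x, z) \<in> Q"
      using xy yz unfolding Q_def by blast
  qed
  then have "acyclic Q"
    unfolding acyclic_def by (simp add: trancl_id) (simp add: Q_def)
  then have "wf Q"
    using \<open>finite Q\<close> by (rule finite_acyclic_wf[rotated])
  moreover obtain z where "z \<in> M - A"
    using M(3) by blast
  ultimately obtain x where x: "x \<in> M - A" and min: "\<And>y. (y, x) \<in> Q \<Longrightarrow> y \<notin> M - A"
    by (rule wfE_min) blast
  have MD: "M - A \<subseteq> ?D"
    using M(4) by blast
  have xD: "x \<in> ?D" and xT: "x \<in> topspace X"
    using x MD by blast+
  let ?W = "cell V x"
  have WA: "?W \<inter> A = {}"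
    using A_compatible in_cell[OF xT] xT x unfolding compatible_def by blast
  have WM: "?W \<subseteq> M"
    using compatible_cell_subset[OF M(2)] x xT by blast
  have MT: "M \<subseteq> topspace X"
    using M(1) by (rule closedin_subset)
  show thesis
  proof (rule that[of ?W])
    show "?W \<in> V" "?W \<noteq> {}"
      using cell_in[OF xT] in_cell[OF xT] by auto
    show "?W \<subseteq> M - A"
      using WA WM by blast
    show "regular X ?W"
      using Inv_critical[OF xD xT] Inv_D[OF xD] by blast
    have "X closure_of {y} \<subseteq> M - ?W" if y: "y \<in> M - ?W" for y
    proof -
      have "X closure_of {y} \<subseteq> M"
        using M(1) y by (simp add: closure_of_minimal)
      moreover have "w \<notin> ?W" if w: "w \<in> X closure_of {y}" for w
      proof
        assume wW: "w \<in> ?W"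
        have "y \<notin> A"
          using w wW WA A_closed by (metis A_sub closedin_finite_iff disjoint_iff finite_X subsetD)
        then have yMA: "y \<in> M - A"
          using y by blast
        have wD: "w \<in> ?D"
          using wW WM WA MD by blast
        have cw: "cell V w = ?W"
          using cell_eq_cell[OF xT wW] .
        have "(y, w) \<in> reach ?D"
          using yMA MD w wD unfolding reach_def Pi_pt_def cl_def by blast
        moreover have "(w, x) \<in> reach ?D"
          using wD xD cw by (rule cellstep)
        moreover have "cell V y \<noteq> ?W"
          using in_cell[of y] y MT by blast
        ultimately have "(y, x) \<in> Q"
          using yMA MD xD unfolding Q_def by auto
        then show False
          using min yMA by blast
      qed
      ultimately show ?thesis
        by blast
    qed
    then show "closedin X (M - ?W)"
      using MT by (subst closedin_finite_iff[OF finite_X]) auto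
    show "compatible X V (M - ?W)"
    proof (rule compatibleI)
      fix y assume y: "y \<in> M - ?W"
      then have yT: "y \<in> topspace X"
        using MT by blast
      have "cell V y \<subseteq> M"
        using compatible_cell_subset[OF M(2)] y yT by blast
      moreover have "cell V y \<inter> ?W = {}"
        using cell_eq_cell[OF xT] cell_eq_cell[OF yT] in_cell[OF yT] y by blast
      ultimately show "cell V y \<subseteq> M - ?W"
        by blast
    qed (use MT in blast)
  qed
qed

end

section \<open>The Morse equation\<close>

lemma trivial_group_exact:
  assumes ex: "exact_seq ([C, B, A], [g, f])" and "trivial_group A" "trivial_group C"
  shows "trivial_group B"
proof -
  have f: "group_hom A B f" and g: "g \<in> hom B C" and ker: "kernel B C g = f ` carrier A"
    using ex by auto
  have "f ` carrier A = {\<one>\<^bsub>B\<^esub>}"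
    using assms(2) group_hom.hom_one[OF f] by (simp add: trivial_group_def)
  moreover have "kernel B C g = carrier B"
    using g assms(3) by (auto simp: kernel_def hom_def trivial_group_def)
  ultimately show ?thesis
    using ker f by (simp add: trivial_group_def group_hom_def)
qed

text \<open>In the exact sequence of the triple, the kernel comes from degree \<open>p\<close> of
  the pair of \<open>S\<close> and \<open>T\<close>, and the obstruction to surjectivity lies in
  degree \<open>p - 1\<close>; both groups vanish.\<close>

lemma hom_induced_triple_iso:
  assumes "T \<subseteq> S" and triv: "\<And>p. trivial_group (relative_homology_group p (subtopology X S) T)"
  shows "hom_induced p X T X S id \<in> iso (relative_homology_group p X T) (relative_homology_group p X S)"
proof -
  let ?j = "hom_induced p X T X S id" and ?d = "hom_relboundary p X S T"
  let ?A = "relative_homology_group p (subtopology X S) T" and ?B = "relative_homology_group p X T"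
    and ?C = "relative_homology_group p X S" and ?D = "relative_homology_group (p - 1) (subtopology X S) T"
  have j: "group_hom ?B ?C ?j"
    by (simp add: group_hom_def group_hom_axioms_def hom_induced_hom)
  have i: "group_hom ?A ?B (hom_induced p (subtopology X S) T X T id)"
    by (simp add: group_hom_def group_hom_axioms_def hom_induced_hom)
  have "kernel ?B ?C ?j = hom_induced p (subtopology X S) T X T id ` carrier ?A"
    using homology_exactness_triple_3[OF assms(1), of p X] by simp
  also have "\<dots> = {\<one>\<^bsub>?B\<^esub>}"
    using triv[of p] group_hom.hom_one[OF i] by (simp add: trivial_group_def)
  finally have inj: "inj_on ?j (carrier ?B)"
    by (simp add: group_hom.inj_iff_trivial_ker[OF j])
  have "?j ` carrier ?B = kernel ?C ?D ?d"
    using homology_exactness_triple_1[OF assms(1), of p X] by simp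
  also have "\<dots> = carrier ?C"
    using triv[of "p - 1"] group_homomorphism_hom_relboundary[of p X S T]
    by (auto simp: kernel_def hom_def trivial_group_def)
  finally show ?thesis
    using inj by (simp add: iso_def bij_betw_def hom_induced_hom)
qed

lemma trivial_group_iso_domain:
  assumes "f \<in> iso G H" "trivial_group G" "group H"
  shows "trivial_group H"
proof -
  have "group_hom G H f"
    using assms by (simp add: group_hom_def group_hom_axioms_def iso_def trivial_group_def)
  then have "f ` {\<one>\<^bsub>G\<^esub>} = {\<one>\<^bsub>H\<^esub>}"
    using group_hom.hom_one by fastforce
  then show ?thesis
    using assms by (simp add: iso_def bij_betw_def trivial_group_def)
qed

text \<open>Closed excision inside \<open>M\<close> for the cover by \<open>cl X W\<close> and
  \<open>M - W\<close>, which meet in \<open>mo X W\<close>. It serves both for a single regular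
  multivector and for the dual repeller in the whole space.\<close>

lemma relative_homology_iso_cl_mo:
  assumes finite_X: "finite (topspace X)" and t0_X: "t0_space X" and W: "W \<subseteq> M"
    and M: "closedin X M" and MW: "closedin X (M - W)"
  shows "hom_induced p (subtopology X (cl X W)) (mo X W) (subtopology X M) (M - W) id
    \<in> iso (relative_homology_group p (subtopology X (cl X W)) (mo X W))
           (relative_homology_group p (subtopology X M) (M - W))"
proof -
  have WM: "W \<subseteq> topspace X" "M \<subseteq> topspace X"
    using W closedin_subset[OF M] by blast+
  have clM: "cl X W \<subseteq> M"
    unfolding cl_def using W M by (rule closure_of_minimal)
  have Wcl: "W \<subseteq> cl X W"
    unfolding cl_def using WM(1) by (rule closure_of_subset)
  have tM: "topspace (subtopology X M) = M"
    using WM(2) by auto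
  have "hom_induced p (subtopology (subtopology X M) (cl X W)) (cl X W \<inter> (M - W)) (subtopology X M) (M - W) id
    \<in> iso (relative_homology_group p (subtopology (subtopology X M) (cl X W)) (cl X W \<inter> (M - W)))
           (relative_homology_group p (subtopology X M) (M - W))"
  proof (rule closed_excision_finite)
    show "finite (topspace (subtopology X M))" "t0_space (subtopology X M)"
      using finite_X t0_X by (simp_all add: t0_space_subtopology)
    have "closedin X (cl X W)"
      by (simp add: cl_def)
    then show "closedin (subtopology X M) (cl X W)" "closedin (subtopology X M) (M - W)"
      using M MW clM by (auto simp: closedin_closed_subtopology)
    show "cl X W \<union> (M - W) = topspace (subtopology X M)"
      unfolding tM using clM Wcl W by blast
  qed
  moreover have "cl X W \<inter> (M - W) = mo X W" "M \<inter> cl X W = cl X W"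
    using clM unfolding mo_def by blast+
  ultimately show ?thesis
    by (simp only: subtopology_subtopology)
qed

lemma betti_closed:
  assumes "closedin X C"
  shows "betti X C i = ab_rank (homology_group (int i) (subtopology X C))"
  using assms by (simp add: betti_def cl_def mo_def closure_of_closedin)

context mvf_attractor
begin

text \<open>For the \<open>W\<close> supplied by \<open>last_multivector\<close>, the pair of
  \<open>M\<close> and \<open>M - W\<close> has the homology of the regular \<open>W\<close>, that
  is, none; the exact sequence of the triple then reduces \<open>M\<close> to the smaller
  \<open>M - W\<close>.\<close>

lemma trivial_homology_between:
  assumes "closedin X M" "compatible X V M" "A \<subseteq> M" "M \<subseteq> N"
  shows "trivial_group (relative_homology_group p (subtopology X M) A)"
  using assms
proof (induction "card M" arbitrary: M p rule: less_induct)
  case less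
  have MT: "M \<subseteq> topspace X"
    using less.prems(1) by (rule closedin_subset)
  show ?case
  proof (cases "M = A")
    case True
    then have "topspace (subtopology X M) = A"
      using MT by auto
    then show ?thesis
      using trivial_relative_homology_group_topspace by metis
  next
    case False
    then have "A \<subset> M"
      using less.prems(3) by blast
    then obtain W where W: "W \<in> V" "W \<noteq> {}" "W \<subseteq> M - A" "regular X W" "closedin X (M - W)" "compatible X V (M - W)"
      using last_multivector[OF less.prems(1,2) _ less.prems(4)] by blast
    have sub: "A \<subseteq> M - W"
      using W(3) less.prems(3) by blast
    have "card (M - W) < card M"
      using W(2,3) MT finite_X by (intro psubset_card_mono) (auto intro: finite_subset)
    then have triv: "trivial_group (relative_homology_group p (subtopology X (M - W)) A)"
      using less.hyps W(5,6) sub less.prems(4) by blast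
    have "M \<inter> (M - W) = M - W"
      by blast
    then have 1: "trivial_group (relative_homology_group p (subtopology (subtopology X M) (M - W)) A)"
      using triv by (simp only: subtopology_subtopology)
    have "trivial_group (relative_homology_group p (subtopology X (cl X W)) (mo X W))"
      using W(4) unfolding regular_def critical_def by blast
    then have "trivial_group (relative_homology_group p (subtopology X M) (M - W))"
      using relative_homology_iso_cl_mo[OF finite_X t0_X _ less.prems(1) W(5)] W(3)
      by (intro trivial_group_iso_domain[where H = "relative_homology_group p (subtopology X M) (M - W)"]) auto
    with 1 show ?thesis
      by (rule trivial_group_exact[OF homology_exactness_triple_3[OF sub]])
  qed
qed

lemma betti_dual_repeller: "betti X R i = ab_rank (relative_homology_group (int i) X A)"
proof -
  have AN: "A \<subseteq> N"
    using A_sub R_sub by blast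
  have compN: "compatible X V N"
    using R_compatible cell_subset unfolding compatible_def by blast
  have iso1: "hom_induced (int i) X A X N id \<in> iso (relative_homology_group (int i) X A) (relative_homology_group (int i) X N)"
    using hom_induced_triple_iso[OF AN] trivial_homology_between[OF N_closed compN AN] by blast
  have RN: "topspace X - R = N" "R \<subseteq> topspace X"
    using R_sub by blast+
  have iso2: "hom_induced (int i) (subtopology X (cl X R)) (mo X R) X N id
    \<in> iso (relative_homology_group (int i) (subtopology X (cl X R)) (mo X R)) (relative_homology_group (int i) X N)"
    using relative_homology_iso_cl_mo[OF finite_X t0_X, of R "topspace X" "int i"] N_closed R_sub by auto
  obtain n where n: "homology_rank (int i) X A n"
    using finite_type_homology_triple_quotient[OF empty_subsetI finite_type_homology_finite_t0 finite_type_homology_finite_t0]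
      finite_X t0_X t0_space_subtopology unfolding finite_type_homology_def
    by (metis finite_Int topspace_subtopology)
  have "homology_rank (int i) (subtopology X (cl X R)) (mo X R) n"
    by (rule homology_rank_iso[OF group.iso_set_sym[OF group_relative_homology_group iso2] homology_rank_iso[OF iso1 n]])
  then show ?thesis
    unfolding betti_def using n by (simp add: comm_group.ab_rank_eqI)
qed

theorem morse_equation:
  "\<exists>q :: int poly. (\<forall>i. poly.coeff q i \<ge> 0) \<and>
     poincare X A + poincare X R = poincare X (topspace X) + (1 + fps_X) * fps_of_poly q \<and>
     (q \<noteq> 0 \<longrightarrow> connection_set X V R A \<noteq> {})"
proof -
  have "finite_type_homology X {}" "finite_type_homology (subtopology X A) {}"
    using finite_X t0_X by (simp_all add: finite_type_homology_finite_t0 t0_space_subtopology)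
  then obtain Q :: "nat \<Rightarrow> nat" and n where Q0: "\<forall>i\<ge>n. Q i = 0"
    and Q: "\<forall>i. ab_rank (homology_group (int i) (subtopology X A)) + ab_rank (relative_homology_group (int i) X A)
       = ab_rank (homology_group (int i) X) + Q i + (if i = 0 then 0 else Q (i - 1))"
    and Qd: "\<forall>i. trivial_homomorphism (relative_homology_group (int i + 1) X A)
            (homology_group (int i) (subtopology X A)) (hom_boundary (int i + 1) X A) \<longrightarrow> Q i = 0"
    by (rule long_exact_rank)
  define q where "q = Abs_poly (\<lambda>i. int (Q i))"
  have coeff: "poly.coeff q i = int (Q i)" for i
    unfolding q_def using Q0 by (subst coeff_Abs_poly[of n]) auto
  have "betti X A i + betti X R i = betti X (topspace X) i + Q i + (if i = 0 then 0 else Q (i - 1))" for i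
    using spec[OF Q, of i] A_closed by (simp add: betti_dual_repeller betti_closed)
  then have "poincare X A + poincare X R = poincare X (topspace X) + (1 + fps_X) * fps_of_poly q"
    by (simp add: fps_eq_iff poincare_def coeff distrib_right flip: of_nat_add)
  moreover have "connection_set X V R A \<noteq> {}" if "q \<noteq> 0"
  proof
    assume "connection_set X V R A = {}"
    then have "openin X A"
      by (rule no_connection_imp_open)
    \<comment> \<open>A nonempty clopen set is a retract, the rest being sent to one of its points,
      so its homology injects into that of \<open>X\<close> and the connecting homomorphism dies;
      the empty set is listed apart, since no nonempty space retracts onto it.\<close>
    then have "A = {} \<or> A retract_of_space X"
      using A_closed retract_of_space_clopen by blast
    then have "Q i = 0" for i
      using trivial_homomorphism_hom_boundary_inclusion[of A X "int i + 1"] spec[OF Qd, of i] by simp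
    then have "q = 0"
      using coeff by (simp add: poly_eq_iff)
    with that show False ..
  qed
  ultimately show ?thesis
    using coeff by (intro exI[of _ q]) simp
qed

end

theorem theorem7p9:
  fixes X :: "'a topology" and V :: "'a set set" and A :: "'a set"
  assumes "finite (topspace X)" and "t0_space X"
    and "multivector_field X V"
    and "invariant X V (topspace X)"
    and "A \<subseteq> topspace X" and "attractor X V A"
  shows "\<exists>q :: int poly. (\<forall>i. poly.coeff q i \<ge> 0) \<and>
     poincare X A + poincare X (Inv X V (topspace X - A)) =
       poincare X (topspace X) + (1 + fps_X) * fps_of_poly q \<and>
     (q \<noteq> 0 \<longrightarrow> connection_set X V (Inv X V (topspace X - A)) A \<noteq> {})"
proof -
  interpret mvf_attractor X V A
    using assms by unfold_locales
  show ?thesis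
    by (rule morse_equation)
qed

end
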